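(* Let $p$ be a prime and $n$ a positive integer. The number of diamonds in the subgroup lattice of the elementary abelian $p$-group $\mathbb{Z}_p^n$ is $$dm(\mathbb{Z}_p^n)=\frac{1}{6}\sum_{i=1}^{\lfloor n/2\rfloor} p^{\frac{i(3i-1)}{2}}\,a_{n,p}(2i)\left(\sum_{j=0}^{n-2i}a_{n-2i,p}(j)\right)\prod_{k=i+1}^{2i}(p^k-1),$$ where, for integers $0\le i\le m$, $$a_{m,p}(i)=\frac{(p^m-1)\cdots(p-1)}{(p^i-1)\cdots(p-1)\,(p^{m-i}-1)\cdots(p-1)}$$ is the number of subgroups of order $p^i$ of $\mathbb{Z}_p^m$ (empty products being $1$).
   Context: For a finite group $G$, $L(G)$ denotes the lattice of all subgroups of $G$ (meet $A\wedge B=A\cap B$, join $A\vee B=\langle A,B\rangle$). A diamond of $G$ is a sublattice of $L(G)$ isomorphic to the diamond lattice $M_5$ (the five-element lattice with a bottom, a top and three pairwise incomparable elements, any two of which meet in the bottom and join to the top). Equivalently, a diamond is an unordered triple $\{A,B,C\}$ of three distinct subgroups of $G$ with $A\wedge B=B\wedge C=C\wedge A$ and $A\vee B=B\vee C=C\vee A$. $dm(G)$ denotes the number of diamonds of $G$. $\mathbb{Z}_p^n$ is the direct product of $n$ copies of the cyclic group $\mathbb{Z}_p$ of order $p$. *)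

theory Defs
  imports "HOL-Algebra.Algebra"
begin

section \<open>Sublattices and isomorphisms of lattices\<close>

definition sublattice :: "'a set \<Rightarrow> ('a, 'b) gorder_scheme \<Rightarrow> bool" where
  "sublattice D L \<longleftrightarrow> D \<noteq> {} \<and> D \<subseteq> carrier L \<and>
     (\<forall>x\<in>D. \<forall>y\<in>D. x \<squnion>\<^bsub>L\<^esub> y \<in> D \<and> x \<sqinter>\<^bsub>L\<^esub> y \<in> D)"

definition lattice_iso ::
    "('a, 'c) gorder_scheme \<Rightarrow> ('b, 'd) gorder_scheme \<Rightarrow> ('a \<Rightarrow> 'b) \<Rightarrow> bool" where
  "lattice_iso K L f \<longleftrightarrow> bij_betw f (carrier K) (carrier L) \<and> join_pres K L f \<and> meet_pres K L f"

lemma (in partial_order) join_eqI: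
  assumes "x \<in> carrier L" "y \<in> carrier L" "z \<in> carrier L" "x \<sqsubseteq> z" "y \<sqsubseteq> z"
    and "\<And>w. w \<in> carrier L \<Longrightarrow> x \<sqsubseteq> w \<Longrightarrow> y \<sqsubseteq> w \<Longrightarrow> z \<sqsubseteq> w"
  shows "x \<squnion> y = z" and "least L z (Upper L {x, y})"
proof -
  show *: "least L z (Upper L {x, y})"
    using assms by (auto simp: least_def Upper_def)
  then show "x \<squnion> y = z"
    unfolding join_def sup_def by (metis least_unique someI_ex)
qed

lemma (in partial_order) meet_eqI:
  assumes "x \<in> carrier L" "y \<in> carrier L" "z \<in> carrier L" "z \<sqsubseteq> x" "z \<sqsubseteq> y"
    and "\<And>w. w \<in> carrier L \<Longrightarrow> w \<sqsubseteq> x \<Longrightarrow> w \<sqsubseteq> y \<Longrightarrow> w \<sqsubseteq> z"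
  shows "x \<sqinter> y = z" and "greatest L z (Lower L {x, y})"
proof -
  show *: "greatest L z (Lower L {x, y})"
    using assms by (auto simp: greatest_def Lower_def)
  then show "x \<sqinter> y = z"
    unfolding meet_def inf_def by (metis greatest_unique someI_ex)
qed

lemma (in lattice) sublattice_restrict:
  assumes D: "sublattice D L"
  shows "lattice (L\<lparr>carrier := D\<rparr>)"
    and "\<And>x y. x \<in> D \<Longrightarrow> y \<in> D \<Longrightarrow> x \<squnion>\<^bsub>L\<lparr>carrier := D\<rparr>\<^esub> y = x \<squnion> y"
    and "\<And>x y. x \<in> D \<Longrightarrow> y \<in> D \<Longrightarrow> x \<sqinter>\<^bsub>L\<lparr>carrier := D\<rparr>\<^esub> y = x \<sqinter> y"
proof -
  let ?M = "L\<lparr>carrier := D\<rparr>"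
  have sub: "D \<subseteq> carrier L" using D by (simp add: sublattice_def)
  interpret M: partial_order ?M
    using sub by unfold_locales (auto simp: eq_is_equal intro: le_trans le_antisym)
  have j: "x \<squnion>\<^bsub>?M\<^esub> y = x \<squnion> y" "least ?M (x \<squnion> y) (Upper ?M {x, y})" if "x \<in> D" "y \<in> D" for x y
    using M.join_eqI[of x y "x \<squnion> y"] that sub D
    by (auto simp: sublattice_def subset_iff intro: join_left join_right join_le)
  have m: "x \<sqinter>\<^bsub>?M\<^esub> y = x \<sqinter> y" "greatest ?M (x \<sqinter> y) (Lower ?M {x, y})" if "x \<in> D" "y \<in> D" for x y
    using M.meet_eqI[of x y "x \<sqinter> y"] that sub D
    by (auto simp: sublattice_def subset_iff intro: meet_left meet_right meet_le)
  show "lattice ?M"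
  proof
    show "\<exists>s. least ?M s (Upper ?M {x, y})" if "x \<in> carrier ?M" "y \<in> carrier ?M" for x y
      using j(2)[of x y] that by auto
    show "\<exists>s. greatest ?M s (Lower ?M {x, y})" if "x \<in> carrier ?M" "y \<in> carrier ?M" for x y
      using m(2)[of x y] that by auto
  qed
  show "x \<squnion>\<^bsub>?M\<^esub> y = x \<squnion> y" if "x \<in> D" "y \<in> D" for x y using j that by blast
  show "x \<sqinter>\<^bsub>?M\<^esub> y = x \<sqinter> y" if "x \<in> D" "y \<in> D" for x y using m that by blast
qed


section \<open>The diamond lattice\<close>

datatype m5 = Bot5 | Mid5_a | Mid5_b | Mid5_c | Top5

definition M5 :: "m5 gorder" where
  "M5 = \<lparr>carrier = UNIV, eq = (=), le = (\<lambda>x y. x = Bot5 \<or> y = Top5 \<or> x = y)\<rparr>"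

definition diamonds :: "('a, 'b) gorder_scheme \<Rightarrow> 'a set set" where
  "diamonds L = {D. sublattice D L \<and> (\<exists>f. lattice_iso M5 (L\<lparr>carrier := D\<rparr>) f)}"

lemma UNIV_m5: "UNIV = {Bot5, Mid5_a, Mid5_b, Mid5_c, Top5}"
  using m5.exhaust by auto

lemma carrier_M5 [simp]: "carrier M5 = UNIV"
  by (simp add: M5_def)

lemma
  shows lattice_M5: "lattice M5"
    and join_M5: "x \<squnion>\<^bsub>M5\<^esub> y = (if x = y \<or> y = Bot5 then x else if x = Bot5 then y else Top5)"
    and meet_M5: "x \<sqinter>\<^bsub>M5\<^esub> y = (if x = y \<or> y = Top5 then x else if x = Top5 then y else Bot5)"
proof -
  interpret partial_order M5
    by unfold_locales (auto simp: M5_def)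
  have le: "x \<sqsubseteq>\<^bsub>M5\<^esub> y \<longleftrightarrow> x = Bot5 \<or> y = Top5 \<or> x = y" for x y
    by (simp add: M5_def)
  have j: "x \<squnion>\<^bsub>M5\<^esub> y = (if x = y \<or> y = Bot5 then x else if x = Bot5 then y else Top5)"
    "least M5 (if x = y \<or> y = Bot5 then x else if x = Bot5 then y else Top5) (Upper M5 {x, y})" for x y
    by (rule join_eqI; auto simp: le)+
  have m: "x \<sqinter>\<^bsub>M5\<^esub> y = (if x = y \<or> y = Top5 then x else if x = Top5 then y else Bot5)"
    "greatest M5 (if x = y \<or> y = Top5 then x else if x = Top5 then y else Bot5) (Lower M5 {x, y})" for x y
    by (rule meet_eqI; auto simp: le)+
  show "lattice M5" by unfold_locales (use j(2) m(2) in blast)+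
  show "x \<squnion>\<^bsub>M5\<^esub> y = (if x = y \<or> y = Bot5 then x else if x = Bot5 then y else Top5)" by (rule j)
  show "x \<sqinter>\<^bsub>M5\<^esub> y = (if x = y \<or> y = Top5 then x else if x = Top5 then y else Bot5)" by (rule m)
qed


section \<open>Subgroup lattices and their diamonds\<close>

definition subgroup_lattice :: "('a, 'b) monoid_scheme \<Rightarrow> 'a set gorder" where
  "subgroup_lattice G = \<lparr>carrier = {H. subgroup H G}, eq = (=), le = (\<subseteq>)\<rparr>"

definition dm :: "('a, 'b) monoid_scheme \<Rightarrow> nat" where
  "dm G = card (diamonds (subgroup_lattice G))"

lemma carrier_subgroup_lattice [simp]: "carrier (subgroup_lattice G) = {H. subgroup H G}"
  by (simp add: subgroup_lattice_def)

context group
begin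

lemma lattice_subgroup_lattice: "lattice (subgroup_lattice G)"
proof -
  interpret complete_lattice "subgroup_lattice G"
    unfolding subgroup_lattice_def by (rule subgroups_complete_lattice)
  show ?thesis by unfold_locales
qed

lemma meet_subgroup_lattice:
  assumes "subgroup A G" "subgroup B G"
  shows "A \<sqinter>\<^bsub>subgroup_lattice G\<^esub> B = A \<inter> B"
proof -
  interpret lattice "subgroup_lattice G" by (rule lattice_subgroup_lattice)
  show ?thesis
    by (rule meet_eqI) (use assms subgroups_Inter_pair in \<open>auto simp: subgroup_lattice_def\<close>)
qed

lemma join_subgroup_lattice:
  assumes "subgroup A G" "subgroup B G"
  shows "A \<squnion>\<^bsub>subgroup_lattice G\<^esub> B = generate G (A \<union> B)"
proof -
  interpret lattice "subgroup_lattice G" by (rule lattice_subgroup_lattice)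
  have "A \<union> B \<subseteq> carrier G" using assms by (auto dest: subgroup.mem_carrier)
  then show ?thesis
    by (intro join_eqI)
      (use assms generate_subgroup_incl[of "A \<union> B"] in
        \<open>auto simp: subgroup_lattice_def generate_is_subgroup intro: generate.incl\<close>)
qed

definition diamond_triple :: "'a set \<Rightarrow> 'a set \<Rightarrow> 'a set \<Rightarrow> bool" where
  "diamond_triple A B C \<longleftrightarrow> subgroup A G \<and> subgroup B G \<and> subgroup C G \<and>
     A \<noteq> B \<and> B \<noteq> C \<and> A \<noteq> C \<and> A \<inter> B = B \<inter> C \<and> B \<inter> C = C \<inter> A \<and>
     generate G (A \<union> B) = generate G (B \<union> C) \<and> generate G (B \<union> C) = generate G (C \<union> A)"

lemma diamond_triple_D:
  assumes "diamond_triple A B C"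
  shows "distinct [A \<inter> B, A, B, C, generate G (A \<union> B)]"
proof -
  have s: "subgroup A G" "subgroup B G" "subgroup C G"
    and n: "A \<noteq> B" "B \<noteq> C" "A \<noteq> C"
    and i: "A \<inter> B = B \<inter> C" "B \<inter> C = C \<inter> A"
    and g: "generate G (A \<union> B) = generate G (B \<union> C)" "generate G (B \<union> C) = generate G (C \<union> A)"
    using assms by (auto simp: diamond_triple_def)
  have sup: "H \<subseteq> generate G (A \<union> B)" if "H \<in> {A, B, C}" for H
    using that g by (auto intro: generate.incl)
  have absorb: "generate G (H \<union> K) = K" if "H \<subseteq> K" "subgroup K G" for H K
    using that generateI[of K "H \<union> K"] by (metis Un_subset_iff sup.absorb2 order_refl)
  have le: "\<not> H \<subseteq> K" if "H \<inter> K = H \<inter> L" "generate G (H \<union> K) = generate G (H \<union> L)"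
    "subgroup K G" "subgroup L G" "K \<noteq> L" for H K L
  proof
    assume "H \<subseteq> K"
    moreover from this that have "H \<subseteq> L" by blast
    ultimately show False using absorb[of H K] absorb[of H L] that by simp
  qed
  have not_sub: "\<not> A \<subseteq> B" "\<not> B \<subseteq> A" "\<not> A \<subseteq> C" "\<not> C \<subseteq> A" "\<not> B \<subseteq> C" "\<not> C \<subseteq> B"
    using le[of A B C] le[of B A C] le[of A C B] le[of C A B] le[of B C A] le[of C B A] s n i g
    by (simp_all add: Un_commute Int_commute)
  have "A \<inter> B \<noteq> A" "A \<inter> B \<noteq> B" "A \<inter> B \<noteq> C"
    using not_sub by blast+
  moreover have "generate G (A \<union> B) \<noteq> A" "generate G (A \<union> B) \<noteq> B" "generate G (A \<union> B) \<noteq> C"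
    using sup[of A] sup[of B] not_sub by auto
  moreover have "A \<inter> B \<noteq> generate G (A \<union> B)"
    using sup[of A] sup[of B] not_sub by auto
  ultimately show ?thesis
    unfolding distinct.simps list.set insert_iff empty_iff using n by metis
qed

lemma diamonds_subgroup_lattice:
  "diamonds (subgroup_lattice G) =
     {{A \<inter> B, A, B, C, generate G (A \<union> B)} | A B C. diamond_triple A B C}" (is "?l = ?r")
proof (intro equalityI subsetI)
  interpret L: lattice "subgroup_lattice G" by (rule lattice_subgroup_lattice)
  fix D
  assume "D \<in> ?l"
  then obtain f where sl: "sublattice D (subgroup_lattice G)"
    and f: "lattice_iso M5 ((subgroup_lattice G)\<lparr>carrier := D\<rparr>) f"
    by (auto simp: diamonds_def)
  have bij: "bij_betw f UNIV D" using f by (simp add: lattice_iso_def)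
  then have D: "f x \<in> D" for x by (auto simp: bij_betw_def)
  then have s: "subgroup (f x) G" for x using sl by (auto simp: sublattice_def)
  have j: "f (x \<squnion>\<^bsub>M5\<^esub> y) = generate G (f x \<union> f y)" for x y
    using f L.sublattice_restrict(2)[OF sl D D, of x y] join_subgroup_lattice[OF s s, of x y]
    by (simp add: lattice_iso_def join_pres_def)
  have m: "f (x \<sqinter>\<^bsub>M5\<^esub> y) = f x \<inter> f y" for x y
    using f L.sublattice_restrict(3)[OF sl D D, of x y] meet_subgroup_lattice[OF s s, of x y]
    by (simp add: lattice_iso_def meet_pres_def)
  let ?A = "f Mid5_a" let ?B = "f Mid5_b" let ?C = "f Mid5_c"
  have "inj f" using bij by (simp add: bij_betw_def)
  then have "diamond_triple ?A ?B ?C"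
    unfolding diamond_triple_def j[symmetric] m[symmetric]
    by (auto simp: s join_M5 meet_M5 inj_eq)
  moreover have "D = f ` {Bot5, Mid5_a, Mid5_b, Mid5_c, Top5}"
    using bij by (simp only: bij_betw_def UNIV_m5)
  then have "D = {?A \<inter> ?B, ?A, ?B, ?C, generate G (?A \<union> ?B)}"
    unfolding j[symmetric] m[symmetric] by (simp add: join_M5 meet_M5)
  ultimately show "D \<in> ?r" by blast
next
  interpret L: lattice "subgroup_lattice G" by (rule lattice_subgroup_lattice)
  fix D
  assume "D \<in> ?r"
  then obtain A B C where t: "diamond_triple A B C"
    and D: "D = {A \<inter> B, A, B, C, generate G (A \<union> B)}" by blast
  let ?T = "generate G (A \<union> B)"
  define f where "f = (\<lambda>x. case x of Bot5 \<Rightarrow> A \<inter> B | Mid5_a \<Rightarrow> A | Mid5_b \<Rightarrow> B | Mid5_c \<Rightarrow> C | Top5 \<Rightarrow> ?T)"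
  have s: "subgroup A G" "subgroup B G" "subgroup C G"
    and i: "A \<inter> B = B \<inter> C" "B \<inter> C = C \<inter> A"
    and g: "?T = generate G (B \<union> C)" "generate G (B \<union> C) = generate G (C \<union> A)"
    using t by (auto simp: diamond_triple_def)
  have "A \<union> B \<subseteq> carrier G" using s by (auto dest: subgroup.mem_carrier)
  then have sf: "subgroup (f x) G" for x
    by (cases x) (auto simp: f_def s subgroups_Inter_pair generate_is_subgroup)
  have sup: "A \<subseteq> ?T" "B \<subseteq> ?T" "C \<subseteq> ?T"
    using g by (auto intro: generate.incl)
  have absorb: "generate G (H \<union> K) = K" "generate G (K \<union> H) = K" if "H \<subseteq> K" "subgroup K G" for H K
    using that generateI[of K "H \<union> K"] by (metis Un_subset_iff Un_commute sup.absorb2 order_refl)+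
  have sT: "subgroup ?T G" and sI: "subgroup (A \<inter> B) G" using sf[of Top5] sf[of Bot5] by (auto simp: f_def)
  have j: "f x \<squnion>\<^bsub>subgroup_lattice G\<^esub> f y = f (x \<squnion>\<^bsub>M5\<^esub> y)" for x y
  proof -
    have le: "f Bot5 \<subseteq> f x" "f x \<subseteq> f Top5" for x
      using sup i by (cases x; auto simp: f_def)+
    have "generate G (f x \<union> f y) = f (x \<squnion>\<^bsub>M5\<^esub> y)"
    proof (cases "x = y \<or> x = Bot5 \<or> y = Bot5 \<or> x = Top5 \<or> y = Top5")
      case True
      have "generate G (f z) = f z" for z using absorb(1)[OF order_refl sf, of z] by simp
      with True show ?thesis using absorb[OF _ sf] le by (elim disjE) (simp_all add: join_M5)
    next
      case False
      then show ?thesis using g by (cases x; cases y) (auto simp: join_M5 f_def Un_commute)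
    qed
    then show ?thesis by (simp add: join_subgroup_lattice sf)
  qed
  have m: "f x \<sqinter>\<^bsub>subgroup_lattice G\<^esub> f y = f (x \<sqinter>\<^bsub>M5\<^esub> y)" for x y
  proof -
    have "f x \<inter> f y = f (x \<sqinter>\<^bsub>M5\<^esub> y)"
      using i sup by (cases x; cases y) (auto simp: meet_M5 f_def)
    then show ?thesis by (simp add: meet_subgroup_lattice sf)
  qed
  have Df: "D = range f"
  proof -
    show ?thesis by (simp add: UNIV_m5 D f_def)
  qed
  have "inj f"
  proof (rule injI)
    fix x y
    show "f x = f y \<Longrightarrow> x = y"
      using diamond_triple_D[OF t] by (cases x; cases y) (auto simp: f_def)
  qed
  then have bij: "bij_betw f UNIV D" using Df by (simp add: bij_betw_def)
  have sl: "sublattice D (subgroup_lattice G)"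
    unfolding sublattice_def Df using sf by (auto simp: j m)
  have "lattice_iso M5 ((subgroup_lattice G)\<lparr>carrier := D\<rparr>) f"
    unfolding lattice_iso_def join_pres_def meet_pres_def
    using bij L.sublattice_restrict[OF sl] Df by (simp add: lattice_M5 j m)
  then show "D \<in> ?l" using sl by (auto simp: diamonds_def)
qed

text \<open>A diamond is determined by its three middle elements, so counting sublattices isomorphic to
  \<^const>\<open>M5\<close> is the same as counting unordered triples.\<close>

lemma dm_eq_card_triples:
  "dm G = card {{A, B, C} | A B C. diamond_triple A B C}" (is "_ = card ?T")
proof -
  let ?h = "\<lambda>T. insert (\<Inter>T) (insert (generate G (\<Union>T)) T)"
  have h: "?h {A, B, C} = {A \<inter> B, A, B, C, generate G (A \<union> B)}"
    and h': "{A, B, C} = ?h {A, B, C} - {\<Inter>(?h {A, B, C}), \<Union>(?h {A, B, C})}"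
    if t: "diamond_triple A B C" for A B C
  proof -
    let ?g = "generate G (A \<union> B)"
    have s: "subgroup A G" "subgroup B G" "subgroup C G"
      and i: "A \<inter> B = B \<inter> C" "B \<inter> C = C \<inter> A"
      and g: "?g = generate G (B \<union> C)" "generate G (B \<union> C) = generate G (C \<union> A)"
      using t by (auto simp: diamond_triple_def)
    have sup: "A \<subseteq> ?g" "B \<subseteq> ?g" "C \<subseteq> ?g"
      using g by (auto intro: generate.incl)
    have "A \<union> B \<subseteq> carrier G" using s by (auto dest: subgroup.mem_carrier)
    then have "?g = generate G (A \<union> B \<union> C)"
      using sup by (intro generateI)
        (auto simp: generate_is_subgroup dest!: generate_subgroup_incl[of "A \<union> B", rotated])
    moreover have "\<Inter>{A, B, C} = A \<inter> B" using i by auto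
    ultimately show 1: "?h {A, B, C} = {A \<inter> B, A, B, C, ?g}"
      by (simp add: Un_assoc insert_commute)
    have 2: "\<Inter>(?h {A, B, C}) = A \<inter> B" "\<Union>(?h {A, B, C}) = ?g"
      unfolding 1 using sup i by auto
    have 3: "{x, a, b, c, y} - {x, y} = {a, b, c}" if "distinct [x, a, b, c, y]" for x a b c y :: "'a set"
      using that by auto
    show "{A, B, C} = ?h {A, B, C} - {\<Inter>(?h {A, B, C}), \<Union>(?h {A, B, C})}"
      unfolding 2 unfolding 1 by (rule 3[OF diamond_triple_D[OF t], symmetric])
  qed
  have inj: "inj_on ?h ?T"
  proof (rule inj_onI)
    have *: "S = ?h S - {\<Inter>(?h S), \<Union>(?h S)}" if S: "S \<in> ?T" for S
    proof -
      obtain A B C where t: "diamond_triple A B C" and S: "S = {A, B, C}" using S by blast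
      show ?thesis unfolding S by (rule h'[OF t])
    qed
    fix S T assume S: "S \<in> ?T" and T: "T \<in> ?T" and eq: "?h S = ?h T"
    have "?h S - {\<Inter>(?h S), \<Union>(?h S)} = ?h T - {\<Inter>(?h T), \<Union>(?h T)}"
      by (simp only: eq)
    then show "S = T" using *[OF S] *[OF T] by (metis (no_types, lifting))
  qed
  have eq: "?h ` ?T = diamonds (subgroup_lattice G)"
  proof -
    have "?T = (\<lambda>(A, B, C). {A, B, C}) ` {(A, B, C). diamond_triple A B C}" (is "_ = _ ` ?R")
      by (auto simp: image_iff)
    then have "?h ` ?T = (\<lambda>(A, B, C). ?h {A, B, C}) ` ?R"
      by (simp only: image_image case_prod_unfold)
    also have "\<dots> = (\<lambda>(A, B, C). {A \<inter> B, A, B, C, generate G (A \<union> B)}) ` ?R"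
      using h by (intro image_cong refl) (simp only: mem_Collect_eq case_prod_unfold)
    also have "\<dots> = diamonds (subgroup_lattice G)"
      unfolding diamonds_subgroup_lattice by (auto simp: image_iff)
    finally show ?thesis .
  qed
  show ?thesis unfolding dm_def eq[symmetric] by (rule card_image[OF inj])
qed

end


section \<open>Elementary abelian groups and Gaussian coefficients\<close>

definition elementary_abelian_group :: "nat \<Rightarrow> nat \<Rightarrow> (nat \<Rightarrow> int) monoid" where
  "elementary_abelian_group p n = product_group {..<n} (\<lambda>_. integer_mod_group p)"

definition gauss_coeff :: "nat \<Rightarrow> nat \<Rightarrow> nat \<Rightarrow> real" where
  "gauss_coeff m p i =
     (\<Prod>k=1..m. (real p ^ k - 1)) / ((\<Prod>k=1..i. (real p ^ k - 1)) * (\<Prod>k=1..m - i. (real p ^ k - 1)))"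
  \<comment> \<open>meaningful only for \<open>i \<le> m\<close>, since \<open>m - i\<close> is truncated\<close>

end

theory Submission
  imports Defs
begin

text \<open>Call a list \<open>xs\<close> of group elements independent over a subgroup \<open>D\<close> if it generates, together
  with \<open>D\<close>, a group of order \<open>card D * p ^ length xs\<close>. Such lists are easy to count, and every other
  count comes from sorting them by what they generate: lists independent over the trivial subgroup
  give the number of subgroups of order \<open>p ^ i\<close>. For diamonds, let \<open>xs\<close> and \<open>ys\<close> be lists of length
  \<open>i\<close> that are jointly independent over \<open>D\<close>. Then \<open>D\<close> together with \<open>xs\<close>, with \<open>ys\<close> and with the list
  of products \<open>xs ! j \<otimes> ys ! j\<close>, respectively, generates the three middle elements \<open>A, B, C\<close> of a
  diamond with bottom \<open>D\<close>. Conversely, given a diamond, \<open>xs\<close> is any independent list of length \<open>i\<close>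
  in \<open>A\<close>, and each \<open>ys ! j\<close> ranges over the elements \<open>b \<in> B\<close> with \<open>xs ! j \<otimes> b \<in> C\<close>, which form a
  coset of \<open>D\<close>. Hence all diamonds with the same \<open>D\<close> and \<open>i\<close> arise from equally many pairs of lists.\<close>


section \<open>Orders of joins\<close>

text \<open>Double counting along a map with fibres of constant size. It yields the product formula,
  the number of subgroups, the factor 6 and the number of diamonds over a given bottom.\<close>

lemma card_uniform_fibres:
  assumes "finite U" "finite Y" "f ` U \<subseteq> Y" "\<And>y. y \<in> Y \<Longrightarrow> card {x \<in> U. f x = y} = k"
  shows "card U = card Y * k"
proof -
  have "card U = (\<Sum>y\<in>Y. card {x \<in> U. f x = y})"
    using sum.group[OF assms(1-3), of "\<lambda>_. 1::nat"] by simp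
  then show ?thesis using assms(4) by simp
qed

text \<open>The pairs with product \<open>a \<otimes> b\<close> are exactly
  \<open>(a \<otimes> t, inv t \<otimes> b)\<close> for \<open>t\<close> in
  \<open>A \<inter> B\<close>, so multiplication from \<open>A \<times> B\<close> onto
  \<open>A <#> B\<close> has fibres of size \<open>card (A \<inter> B)\<close>.\<close>

lemma (in group) card_set_mult:
  assumes A: "subgroup A G" and B: "subgroup B G" and fin: "finite A" "finite B"
  shows "card A * card B = card (A <#> B) * card (A \<inter> B)"
proof -
  interpret A: subgroup A G by (rule A)
  interpret B: subgroup B G by (rule B)
  have "card (A \<times> B) = card (A <#> B) * card (A \<inter> B)"
  proof (rule card_uniform_fibres[where f = "\<lambda>(a, b). a \<otimes> b"])
    show "finite (A <#> B)" unfolding set_mult_def using fin by auto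
    fix y assume "y \<in> A <#> B"
    then obtain a b where ab: "a \<in> A" "b \<in> B" "y = a \<otimes> b" by (auto simp: set_mult_def)
    have "bij_betw (\<lambda>t. (a \<otimes> t, inv t \<otimes> b)) (A \<inter> B) {x \<in> A \<times> B. (case x of (a, b) \<Rightarrow> a \<otimes> b) = y}"
    proof (rule bij_betw_byWitness[where f' = "\<lambda>(a', b'). inv a \<otimes> a'"])
      show "\<forall>t\<in>A \<inter> B. (case (a \<otimes> t, inv t \<otimes> b) of (a', b') \<Rightarrow> inv a \<otimes> a') = t"
        using ab by (auto simp: m_assoc[symmetric])
      have *: "inv a \<otimes> a' = b \<otimes> inv b'" if "a' \<in> A" "b' \<in> B" "a' \<otimes> b' = a \<otimes> b" for a' b'
        using that ab by (metis A.mem_carrier B.mem_carrier inv_closed inv_solve_left inv_solve_right m_assoc m_closed)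
      have "inv (inv a \<otimes> a') \<otimes> b = b'" if "a' \<in> A" "b' \<in> B" "a' \<otimes> b' = a \<otimes> b" for a' b'
      proof -
        have "inv (inv a \<otimes> a') \<otimes> b = inv a' \<otimes> (a \<otimes> b)"
          using that ab by (simp add: inv_mult_group m_assoc)
        also have "\<dots> = b'" using that by (simp flip: that(3) m_assoc)
        finally show ?thesis .
      qed
      then show "\<forall>x\<in>{x \<in> A \<times> B. (case x of (a, b) \<Rightarrow> a \<otimes> b) = y}.
          (a \<otimes> (case x of (a', b') \<Rightarrow> inv a \<otimes> a'), inv (case x of (a', b') \<Rightarrow> inv a \<otimes> a') \<otimes> b) = x"
        using ab by (auto simp: m_assoc[symmetric])
      show "(\<lambda>t. (a \<otimes> t, inv t \<otimes> b)) ` (A \<inter> B) \<subseteq> {x \<in> A \<times> B. (case x of (a, b) \<Rightarrow> a \<otimes> b) = y}"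
        using ab by (auto simp: m_assoc) (simp flip: m_assoc)
      show "(\<lambda>(a', b'). inv a \<otimes> a') ` {x \<in> A \<times> B. (case x of (a, b) \<Rightarrow> a \<otimes> b) = y} \<subseteq> A \<inter> B"
        using ab * by auto
    qed
    from bij_betw_same_card[OF this]
    show "card {x \<in> A \<times> B. (case x of (a, b) \<Rightarrow> a \<otimes> b) = y} = card (A \<inter> B)" by simp
  qed (use fin in \<open>auto simp: set_mult_def\<close>)
  then show ?thesis by (simp add: card_cartesian_product)
qed

lemma (in comm_group) generate_Un_subgroups:
  assumes A: "subgroup A G" and B: "subgroup B G"
  shows "generate G (A \<union> B) = A <#> B"
proof (rule generateI[symmetric])
  interpret A: subgroup A G by (rule A)
  interpret B: subgroup B G by (rule B)
  show "subgroup (A <#> B) G" by (rule mult_subgroups[OF A B])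
  have "x \<otimes> \<one> \<in> A <#> B" if "x \<in> A" for x
    using that B.one_closed unfolding set_mult_def by blast
  then have "x \<in> A <#> B" if "x \<in> A" for x
    using that by fastforce
  moreover have "\<one> \<otimes> x \<in> A <#> B" if "x \<in> B" for x
    using that A.one_closed unfolding set_mult_def by blast
  then have "x \<in> A <#> B" if "x \<in> B" for x
    using that by fastforce
  ultimately show "A \<union> B \<subseteq> A <#> B" by blast
  show "A <#> B \<subseteq> K" if "subgroup K G" "A \<union> B \<subseteq> K" for K
  proof
    fix x assume "x \<in> A <#> B"
    then obtain a b where "a \<in> A" "b \<in> B" "x = a \<otimes> b" unfolding set_mult_def by blast
    then show "x \<in> K" using that(2) subgroup.m_closed[OF that(1)] by blast
  qed
qed

lemma (in group) generate_absorb: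
  assumes "U \<subseteq> carrier G" "Y \<subseteq> carrier G"
  shows "generate G (generate G U \<union> Y) = generate G (U \<union> Y)"
proof (rule antisym)
  have s: "subgroup (generate G (U \<union> Y)) G" using assms by (intro generate_is_subgroup) auto
  show "generate G (generate G U \<union> Y) \<subseteq> generate G (U \<union> Y)"
    by (intro generate_subgroup_incl[OF _ s] Un_least mono_generate) (auto intro: generate.incl)
  show "generate G (U \<union> Y) \<subseteq> generate G (generate G U \<union> Y)"
    by (intro mono_generate) (auto intro: generate.incl)
qed

text \<open>All counting takes place in this abstract form of Z_p^n; the concrete product group
  enters only at the end, as an instance.\<close>

locale elementary_abelian = comm_group G for G (structure) +
  fixes p n :: nat
  assumes prime_p: "Factorial_Ring.prime p"
    and order_G: "order G = p ^ n"
    and pow_p: "x \<in> carrier G \<Longrightarrow> x [^] p = \<one>"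
begin

lemma p_gt_1: "p > 1"
  by (rule prime_gt_1_nat[OF prime_p])

lemma finite_carrier: "finite (carrier G)"
  using order_G p_gt_1 order_gt_0_iff_finite by simp

lemma finite_subgroup: "subgroup H G \<Longrightarrow> finite H"
  by (rule finite_subset[OF subgroup.subset finite_carrier])

lemma card_subgroup_pos: "subgroup H G \<Longrightarrow> card H > 0"
  using finite_subgroup[of H] subgroup.one_closed[of H G] by (auto simp: card_gt_0_iff)

lemma card_subgroup_power:
  assumes "subgroup H G"
  obtains k where "k \<le> n" "card H = p ^ k"
proof -
  have "card H dvd p ^ n" using lagrange[OF assms] order_G by (metis dvd_triv_right)
  then show ?thesis using that divides_primepow_nat[OF prime_p] by blast
qed

text \<open>By \<open>pow_p\<close> the subgroup generated by \<open>x\<close> has order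
  \<open>p\<close>. It meets \<open>D\<close> in a subgroup whose order is a power of
  \<open>p\<close> below \<open>p\<close>, hence trivially, and the product formula gives the factor
  \<open>p\<close>.\<close>

lemma card_generate_insert:
  assumes D: "subgroup D G" and x: "x \<in> carrier G" "x \<notin> D"
  shows "card (generate G (insert x D)) = p * card D"
proof -
  have x1: "x \<noteq> \<one>" using x subgroup.one_closed[OF D] by blast
  have "ord x dvd p" using pow_eq_id[OF x(1), of p] pow_p[OF x(1)] by simp
  then have "ord x = p"
    using x1 ord_eq_1[OF x(1)] prime_p by (meson prime_nat_iff)
  let ?U = "generate G {x}"
  have U: "subgroup ?U G" and cU: "card ?U = p"
    using generate_is_subgroup[of "{x}"] x generate_pow_card[OF x(1)] \<open>ord x = p\<close> by auto
  have DU: "subgroup (D \<inter> ?U) G" by (rule subgroups_Inter_pair[OF D U])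
  have "D \<inter> ?U \<noteq> ?U" using x(2) generate.incl[of x "{x}" G] by blast
  then have "card (D \<inter> ?U) < p"
    using psubset_card_mono[OF finite_subgroup[OF U], of "D \<inter> ?U"] cU by blast
  moreover obtain k where "card (D \<inter> ?U) = p ^ k"
    using card_subgroup_power[OF DU] by blast
  ultimately have "card (D \<inter> ?U) = 1"
    using p_gt_1 power_strict_increasing_iff[of p k 1] by simp
  then have "card D * p = card (D <#> ?U)"
    using card_set_mult[OF D U] finite_subgroup[OF D] finite_subgroup[OF U] cU by simp
  also have "D <#> ?U = generate G (?U \<union> D)"
    using generate_Un_subgroups[OF D U] by (simp add: Un_commute)
  also have "\<dots> = generate G (insert x D)"
    using generate_absorb[of "{x}" D] x subgroup.subset[OF D] by simp
  finally show ?thesis by (simp only: mult.commute)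
qed


section \<open>Independent lists\<close>

text \<open>With \<open>G\<close> viewed as a vector space over the field of \<open>p\<close>
  elements and \<open>D\<close> a subgroup, this is linear independence modulo \<open>D\<close>; the
  condition on orders expresses it without scalars or quotients.\<close>

definition indep :: "'a set \<Rightarrow> 'a list \<Rightarrow> bool" where
  "indep D xs \<longleftrightarrow> set xs \<subseteq> carrier G \<and> card (generate G (D \<union> set xs)) = card D * p ^ length xs"

lemma generate_idem: "subgroup D G \<Longrightarrow> generate G D = D"
  by (rule generateI[symmetric]) auto

lemma generate_Un_Cons:
  assumes "D \<subseteq> carrier G" "set (x # xs) \<subseteq> carrier G"
  shows "generate G (D \<union> set (x # xs)) = generate G (generate G (insert x D) \<union> set xs)"
  using assms generate_absorb[of "insert x D" "set xs"] by simp

lemma subgroup_insert: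
  assumes "subgroup D G" "x \<in> carrier G"
  shows "subgroup (generate G (insert x D)) G"
  using assms subgroup.subset by (intro generate_is_subgroup) auto

lemma card_generate_insert_le:
  assumes D: "subgroup D G" and x: "x \<in> carrier G"
  shows "card (generate G (insert x D)) \<le> p * card D"
  using card_generate_insert[OF D x] generate_idem[OF D] p_gt_1
  by (cases "x \<in> D") (auto simp: insert_absorb)

lemma card_generate_le:
  assumes "subgroup D G" "set xs \<subseteq> carrier G"
  shows "card (generate G (D \<union> set xs)) \<le> card D * p ^ length xs"
  using assms
proof (induction xs arbitrary: D)
  case Nil
  then show ?case by (simp add: generate_idem)
next
  case (Cons x xs)
  have "card (generate G (D \<union> set (x # xs))) \<le> card (generate G (insert x D)) * p ^ length xs"
    unfolding generate_Un_Cons[OF subgroup.subset[OF Cons.prems(1)] Cons.prems(2)]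
    using Cons.prems by (intro Cons.IH subgroup_insert) auto
  also have "\<dots> \<le> p * card D * p ^ length xs"
    using Cons.prems by (intro mult_right_mono card_generate_insert_le) auto
  finally show ?case by (simp add: mult_ac)
qed

lemma indep_Nil: "subgroup D G \<Longrightarrow> indep D []"
  by (simp add: indep_def generate_idem)

text \<open>If \<open>x\<close> lies outside \<open>D\<close>, adding it to the base multiplies the
  order by \<open>p\<close>, and the two order conditions coincide. If \<open>x\<close> is in
  \<open>D\<close>, the tail alone cannot reach the required order, by
  \<open>card_generate_le\<close>.\<close>

lemma indep_Cons:
  assumes D: "subgroup D G"
  shows "indep D (x # xs) \<longleftrightarrow> x \<in> carrier G \<and> x \<notin> D \<and> indep (generate G (insert x D)) xs"
proof (cases "set (x # xs) \<subseteq> carrier G")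
  case True
  note gen = generate_Un_Cons[OF subgroup.subset[OF D] True]
  show ?thesis
  proof (cases "x \<in> D")
    case True': True
    have "card (generate G (D \<union> set (x # xs))) \<le> card D * p ^ length xs"
      using card_generate_le[OF D, of xs] True gen generate_idem[OF D] True' by (simp add: insert_absorb)
    also have "\<dots> < card D * p ^ length (x # xs)"
      using card_subgroup_pos[OF D] p_gt_1 by simp
    finally show ?thesis using True' by (simp add: indep_def)
  next
    case False
    then show ?thesis
      using True card_generate_insert[OF D] gen by (simp add: indep_def mult_ac)
  qed
qed (auto simp: indep_def)

definition indep_lists :: "'a set \<Rightarrow> 'a set \<Rightarrow> nat \<Rightarrow> 'a list set" where
  "indep_lists D S i = {xs. set xs \<subseteq> S \<and> length xs = i \<and> indep D xs}"

lemma finite_indep_lists: "finite S \<Longrightarrow> finite (indep_lists D S i)"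
  unfolding indep_lists_def
  by (rule finite_subset[OF _ finite_lists_length_eq[of S i]]) auto

text \<open>Choose the entries one by one: entry \<open>k\<close> must avoid the subgroup of order
  \<open>card D * p ^ k\<close> generated so far. For \<open>i\<close> too large, the factor with
  \<open>card D * p ^ k = card S\<close> makes the product zero.\<close>

lemma card_indep_lists:
  assumes "subgroup D G" "subgroup S G" "D \<subseteq> S"
  shows "card (indep_lists D S i) = (\<Prod>k<i. card S - card D * p ^ k)"
  using assms
proof (induction i arbitrary: D)
  case 0
  then have "indep_lists D S 0 = {[]}" by (auto simp: indep_lists_def indep_Nil)
  then show ?case by simp
next
  case (Suc i)
  note D = Suc.prems(1) and S = Suc.prems(2) and sub = Suc.prems(3)
  let ?L = "\<lambda>x. indep_lists (generate G (insert x D)) S i"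
  have fin: "finite S" by (rule finite_subgroup[OF S])
  have eq: "indep_lists D S (Suc i) = (\<lambda>(x, xs). x # xs) ` (SIGMA x:S - D. ?L x)"
    using subgroup.mem_carrier[OF S]
    by (auto simp: indep_lists_def indep_Cons[OF D] length_Suc_conv image_iff)
  have "card (indep_lists D S (Suc i)) = card (SIGMA x:S - D. ?L x)"
    unfolding eq by (rule card_image) (auto simp: inj_on_def)
  also have "\<dots> = (\<Sum>x\<in>S - D. card (?L x))"
    using fin finite_indep_lists by (subst card_SigmaI) auto
  also have "\<dots> = (\<Sum>x\<in>S - D. \<Prod>k<i. card S - card D * p ^ Suc k)"
  proof (rule sum.cong[OF refl])
    fix x assume x: "x \<in> S - D"
    then have xc: "x \<in> carrier G" using subgroup.mem_carrier[OF S] by blast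
    have "card (?L x) = (\<Prod>k<i. card S - card (generate G (insert x D)) * p ^ k)"
      using x xc sub S by (intro Suc.IH subgroup_insert D generate_subgroup_incl) auto
    also have "\<dots> = (\<Prod>k<i. card S - card D * p ^ Suc k)"
      using card_generate_insert[OF D xc] x by (simp add: mult_ac)
    finally show "card (?L x) = (\<Prod>k<i. card S - card D * p ^ Suc k)" .
  qed
  also have "\<dots> = (card S - card D) * (\<Prod>k<i. card S - card D * p ^ Suc k)"
    by (simp add: card_Diff_subset[OF finite_subset[OF sub fin] sub])
  also have "\<dots> = (\<Prod>k<Suc i. card S - card D * p ^ k)"
    by (simp only: prod.lessThan_Suc_shift) simp
  finally show ?case .
qed

text \<open>Both sides count the lists of length \<open>i\<close> independent over the trivial
  subgroup: sorted by the generated subgroup on the left, directly on the right.\<close>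

lemma card_subgroups_mult:
  "card {H. subgroup H G \<and> card H = p ^ i} * (\<Prod>k<i. p ^ i - p ^ k) = (\<Prod>k<i. p ^ n - p ^ k)"
proof -
  have t: "subgroup {\<one>} G" by (rule triv_subgroup)
  have span: "generate G (insert \<one> U) = generate G U" if "U \<subseteq> carrier G" for U
    using generate_absorb[of "{}" U] that by (simp add: generate_empty)
  have "card (indep_lists {\<one>} (carrier G) i) = card {H. subgroup H G \<and> card H = p ^ i} * (\<Prod>k<i. p ^ i - p ^ k)"
  proof (rule card_uniform_fibres[where f = "\<lambda>xs. generate G (set xs)"])
    show "finite (indep_lists {\<one>} (carrier G) i)" by (rule finite_indep_lists[OF finite_carrier])
    show "finite {H. subgroup H G \<and> card H = p ^ i}"
      by (rule finite_subset[of _ "Pow (carrier G)"]) (auto simp: finite_carrier dest: subgroup.mem_carrier)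
    show "(\<lambda>xs. generate G (set xs)) ` indep_lists {\<one>} (carrier G) i \<subseteq> {H. subgroup H G \<and> card H = p ^ i}"
      by (auto simp: indep_lists_def indep_def span intro: generate_is_subgroup)
    fix H assume "H \<in> {H. subgroup H G \<and> card H = p ^ i}"
    then have H: "subgroup H G" "card H = p ^ i" by auto
    \<comment> \<open>An independent list of length \<open>i\<close> inside \<open>H\<close>
      generates a subgroup of \<open>H\<close> of order \<open>p ^ i = card H\<close>, hence all of
      \<open>H\<close>.\<close>
    have "{xs \<in> indep_lists {\<one>} (carrier G) i. generate G (set xs) = H} = indep_lists {\<one>} H i"
    proof (intro equalityI subsetI)
      fix xs assume "xs \<in> {xs \<in> indep_lists {\<one>} (carrier G) i. generate G (set xs) = H}"
      then show "xs \<in> indep_lists {\<one>} H i"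
        by (auto simp: indep_lists_def intro: generate.incl)
    next
      fix xs assume xs: "xs \<in> indep_lists {\<one>} H i"
      then have c: "set xs \<subseteq> carrier G" and sub: "generate G (set xs) \<subseteq> H"
        using H subgroup.subset[OF H(1)] generate_subgroup_incl[of "set xs" H] by (auto simp: indep_lists_def)
      have "card (generate G (set xs)) = card H"
        using xs H span[OF c] by (auto simp: indep_lists_def indep_def)
      then have "generate G (set xs) = H"
        by (rule card_subset_eq[OF finite_subgroup[OF H(1)] sub])
      then show "xs \<in> {xs \<in> indep_lists {\<one>} (carrier G) i. generate G (set xs) = H}"
        using xs c by (auto simp: indep_lists_def)
    qed
    then show "card {xs \<in> indep_lists {\<one>} (carrier G) i. generate G (set xs) = H} = (\<Prod>k<i. p ^ i - p ^ k)"
      using card_indep_lists[OF t H(1)] H subgroup.one_closed[OF H(1)] by simp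
  qed
  moreover have "card (indep_lists {\<one>} (carrier G) i) = (\<Prod>k<i. p ^ n - p ^ k)"
    using card_indep_lists[OF t subgroup_self] order_G by (simp add: order_def)
  ultimately show ?thesis by simp
qed
end


section \<open>Diamonds with a given bottom\<close>

text \<open>The entries of \<open>ys\<close> are chosen independently of each other. For a diamond,
  \<open>P a b\<close> will say that \<open>b\<close> is in \<open>B\<close> and
  \<open>a \<otimes> b\<close> is in \<open>C\<close>.\<close>

lemma card_list_all2:
  assumes "\<And>a. a \<in> set xs \<Longrightarrow> card {b. P a b} = k"
  shows "card {ys. list_all2 P xs ys} = k ^ length xs"
  using assms
proof (induction xs)
  case (Cons x xs)
  have "{ys. list_all2 P (x # xs) ys} = (\<lambda>(b, ys). b # ys) ` ({b. P x b} \<times> {ys. list_all2 P xs ys})"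
    by (auto simp: list_all2_Cons1 image_iff)
  then have "card {ys. list_all2 P (x # xs) ys} = card ({b. P x b} \<times> {ys. list_all2 P xs ys})"
    by (simp only:) (rule card_image, auto simp: inj_on_def)
  then show ?case using Cons by (simp add: card_cartesian_product)
next
  case Nil
  have "{ys. list_all2 P [] ys} = {[]}" by auto
  then show ?case by simp
qed

text \<open>If two of \<open>x\<close>, \<open>y\<close>, \<open>x \<otimes> y\<close> lie in a
  subgroup, so does the third. Hence any two of \<open>xs\<close>, \<open>ys\<close> and their list
  of products generate the same subgroup.\<close>

lemma (in group) map2_mult_in_subgroup:
  assumes "subgroup H G" "length xs = length ys" "set xs \<subseteq> carrier G" "set ys \<subseteq> carrier G"
  shows "set xs \<subseteq> H \<Longrightarrow> set (map2 (\<otimes>) xs ys) \<subseteq> H \<longleftrightarrow> set ys \<subseteq> H"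
    and "set ys \<subseteq> H \<Longrightarrow> set (map2 (\<otimes>) xs ys) \<subseteq> H \<longleftrightarrow> set xs \<subseteq> H"
proof -
  interpret H: subgroup H G by fact
  have l: "x \<otimes> y \<in> H \<longleftrightarrow> y \<in> H" if "x \<in> H" "y \<in> carrier G" for x y
    using that inv_solve_left[of y x "x \<otimes> y"] by (metis H.m_closed H.m_inv_closed H.mem_carrier m_closed)
  have r: "x \<otimes> y \<in> H \<longleftrightarrow> x \<in> H" if "y \<in> H" "x \<in> carrier G" for x y
    using that inv_solve_right[of x "x \<otimes> y" y] by (metis H.m_closed H.m_inv_closed H.mem_carrier m_closed)
  show "set xs \<subseteq> H \<Longrightarrow> set (map2 (\<otimes>) xs ys) \<subseteq> H \<longleftrightarrow> set ys \<subseteq> H"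
    using assms(2-) by (induction xs ys rule: list_induct2) (auto simp: l)
  show "set ys \<subseteq> H \<Longrightarrow> set (map2 (\<otimes>) xs ys) \<subseteq> H \<longleftrightarrow> set xs \<subseteq> H"
    using assms(2-) by (induction xs ys rule: list_induct2) (auto simp: r)
qed

lemma (in group) subgroup_generate_Un:
  assumes "subgroup A G" "subgroup B G"
  shows "subgroup (generate G (A \<union> B)) G"
  using assms[THEN subgroup.subset] by (intro generate_is_subgroup) simp

section \<open>Ordered diamonds and jointly independent pairs of lists\<close>

context elementary_abelian
begin

lemma card_generate_Un:
  assumes "subgroup A G" "subgroup B G"
  shows "card A * card B = card (generate G (A \<union> B)) * card (A \<inter> B)"
  using card_set_mult[OF assms] assms by (simp add: finite_subgroup generate_Un_subgroups)

text \<open>Ordered triples of middle elements. For a subgroup \<open>D\<close>, distinctness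
  follows from the orders when \<open>i \<ge> 1\<close>; for \<open>i = 0\<close> the only member is
  \<open>(D, D, D)\<close>.\<close>

definition diamond_triples_over :: "'a set \<Rightarrow> nat \<Rightarrow> ('a set \<times> 'a set \<times> 'a set) set" where
  "diamond_triples_over D i = {(A, B, C). subgroup A G \<and> subgroup B G \<and> subgroup C G \<and>
     A \<inter> B = D \<and> B \<inter> C = D \<and> C \<inter> A = D \<and>
     generate G (A \<union> B) = generate G (B \<union> C) \<and> generate G (B \<union> C) = generate G (C \<union> A) \<and>
     card A = card D * p ^ i \<and> card B = card D * p ^ i \<and> card C = card D * p ^ i}"

text \<open>Joint independence over \<open>D\<close>, split into two stages so that
  \<open>card_indep_lists\<close> counts each; \<open>mem_indep_pairs\<close> gives a form symmetric
  in \<open>xs\<close> and \<open>ys\<close>.\<close>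

definition indep_pairs :: "'a set \<Rightarrow> nat \<Rightarrow> ('a list \<times> 'a list) set" where
  "indep_pairs D i =
     (SIGMA xs:indep_lists D (carrier G) i. indep_lists (generate G (D \<union> set xs)) (carrier G) i)"

lemma card_indep_pairs:
  assumes D: "subgroup D G"
  shows "card (indep_pairs D i) = (\<Prod>k<2 * i. p ^ n - card D * p ^ k)"
proof -
  have ab: "(\<Prod>k<i. f k) * (\<Prod>k<j. f (i + k)) = (\<Prod>k<i + j. f k)" for f :: "nat \<Rightarrow> nat" and j
    by (induction j) (simp_all flip: mult.assoc)
  have "card (indep_pairs D i) =
      (\<Sum>xs\<in>indep_lists D (carrier G) i. card (indep_lists (generate G (D \<union> set xs)) (carrier G) i))"
    unfolding indep_pairs_def using finite_carrier finite_indep_lists by (subst card_SigmaI) auto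
  also have "\<dots> = (\<Sum>xs\<in>indep_lists D (carrier G) i. \<Prod>k<i. p ^ n - card D * p ^ (i + k))"
  proof (rule sum.cong[OF refl])
    fix xs assume xs: "xs \<in> indep_lists D (carrier G) i"
    then have "subgroup (generate G (D \<union> set xs)) G"
      using subgroup.subset[OF D] by (intro generate_is_subgroup) (auto simp: indep_lists_def)
    from card_indep_lists[OF this subgroup_self subgroup.subset[OF this]] xs
    show "card (indep_lists (generate G (D \<union> set xs)) (carrier G) i) = (\<Prod>k<i. p ^ n - card D * p ^ (i + k))"
      using order_G by (simp add: indep_lists_def indep_def order_def power_add mult_ac)
  qed
  also have "\<dots> = (\<Prod>k<i. p ^ n - card D * p ^ k) * (\<Prod>k<i. p ^ n - card D * p ^ (i + k))"
    using card_indep_lists[OF D subgroup_self subgroup.subset[OF D], of i] order_G by (simp add: order_def)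
  finally show ?thesis using ab[of "\<lambda>k. p ^ n - card D * p ^ k" i] by (simp add: mult_2)
qed

lemma generate_Un_Un:
  assumes "D \<subseteq> carrier G" "U \<subseteq> carrier G" "V \<subseteq> carrier G"
  shows "generate G (generate G (D \<union> U) \<union> generate G (D \<union> V)) = generate G (D \<union> U \<union> V)"
proof -
  have "generate G (generate G (D \<union> U) \<union> generate G (D \<union> V)) = generate G (D \<union> U \<union> generate G (D \<union> V))"
    using assms generate_in_carrier[of "D \<union> V"] by (intro generate_absorb) auto
  also have "\<dots> = generate G (D \<union> V \<union> (D \<union> U))"
    using assms generate_absorb[of "D \<union> V" "D \<union> U"] by (simp add: Un_commute)
  also have "D \<union> V \<union> (D \<union> U) = D \<union> U \<union> V" by blast
  finally show ?thesis .
qed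

text \<open>Each of the two stages enlarges the order by a factor of at most \<open>p ^ i\<close>,
  so a total factor of \<open>p ^ i * p ^ i\<close> forces both to attain the maximum.\<close>

lemma mem_indep_pairs:
  assumes D: "subgroup D G"
  shows "(xs, ys) \<in> indep_pairs D i \<longleftrightarrow>
    set xs \<subseteq> carrier G \<and> length xs = i \<and> set ys \<subseteq> carrier G \<and> length ys = i \<and>
    card (generate G (D \<union> set xs \<union> set ys)) = card D * (p ^ i * p ^ i)" (is "?l \<longleftrightarrow> ?r")
proof (cases "set xs \<subseteq> carrier G \<and> length xs = i \<and> set ys \<subseteq> carrier G \<and> length ys = i")
  case True
  let ?A = "generate G (D \<union> set xs)"
  have Dc: "D \<subseteq> carrier G" by (rule subgroup.subset[OF D])
  have A: "subgroup ?A G" using Dc True by (intro generate_is_subgroup) auto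
  have gen: "generate G (?A \<union> set ys) = generate G (D \<union> set xs \<union> set ys)"
    using generate_absorb[of "D \<union> set xs" "set ys"] Dc True by simp
  have le: "card ?A \<le> card D * p ^ i" "card (generate G (D \<union> set xs \<union> set ys)) \<le> card ?A * p ^ i"
    using card_generate_le[OF D, of xs] card_generate_le[OF A, of ys] True gen by auto
  have "card ?A = card D * p ^ i" if "card (generate G (D \<union> set xs \<union> set ys)) = card D * (p ^ i * p ^ i)"
    using le that p_gt_1 by (intro antisym) (simp_all flip: mult.assoc)
  then show ?thesis using True gen by (auto simp: indep_pairs_def indep_lists_def indep_def mult.assoc)
qed (auto simp: indep_pairs_def indep_lists_def)

text \<open>As \<open>A \<inter> B\<close> contains \<open>D\<close>, the product formula bounds
  \<open>card A * card B\<close> from below by the square of \<open>card D * q\<close>. The upper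
  bounds on the two factors turn every inequality into an equality.\<close>

lemma independent_subgroups:
  assumes D: "subgroup D G" "D \<subseteq> A" "D \<subseteq> B" and A: "subgroup A G" and B: "subgroup B G"
    and le: "card A \<le> card D * q" "card B \<le> card D * q"
    and eq: "card (generate G (A \<union> B)) = card D * (q * q)" and q: "q > 0"
  shows "A \<inter> B = D \<and> card A = card D * q \<and> card B = card D * q"
proof -
  have d: "card D > 0" by (rule card_subgroup_pos[OF D(1)])
  have AB: "subgroup (A \<inter> B) G" by (rule subgroups_Inter_pair[OF A B])
  have m: "card A * card B = card D * (q * q) * card (A \<inter> B)"
    using card_generate_Un[OF A B] eq by simp
  also have "\<dots> \<ge> card D * q * (card D * q)"
    using card_mono[OF finite_subgroup[OF AB], of D] D(2,3) by simp
  finally have ge: "card D * q * (card D * q) \<le> card A * card B" .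
  have cA: "card A = card D * q"
  proof (rule ccontr)
    assume "card A \<noteq> card D * q"
    then have "card A * card B < card D * q * (card D * q)"
      using le d q card_subgroup_pos[OF B] by (intro mult_less_le_imp_less) auto
    then show False using ge by simp
  qed
  have cB: "card B = card D * q"
    using ge le(2) cA d q by (intro antisym) auto
  have "card (A \<inter> B) = card D" using m cA cB d q by simp
  then have "D = A \<inter> B" using D(2,3) by (intro card_subset_eq[OF finite_subgroup[OF AB]]) auto
  then show ?thesis using cA cB by simp
qed

text \<open>\<open>A\<close> lies in the join \<open>C <#> B\<close>, so
  \<open>a = c \<otimes> b0\<close>. Then \<open>a \<otimes> b\<close> is in \<open>C\<close> iff
  \<open>b0 \<otimes> b\<close> is in \<open>B \<inter> C = D\<close>, and the matching
  \<open>b\<close> form the coset of \<open>D\<close> through \<open>inv b0\<close>.\<close>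

lemma card_matching:
  assumes t: "(A, B, C) \<in> diamond_triples_over D i" and a: "a \<in> A"
  shows "card {b. b \<in> B \<and> a \<otimes> b \<in> C} = card D"
proof -
  have s: "subgroup A G" "subgroup B G" "subgroup C G" and int: "B \<inter> C = D"
    and g: "generate G (A \<union> B) = generate G (C \<union> B)"
    using t by (auto simp: diamond_triples_over_def Un_commute)
  interpret B: subgroup B G by (rule s)
  interpret C: subgroup C G by (rule s)
  have "a \<in> C <#> B"
    using a g generate.incl[of a "A \<union> B" G] generate_Un_subgroups[OF s(3,2)] by auto
  then obtain c b0 where c: "c \<in> C" "b0 \<in> B" "a = c \<otimes> b0" by (auto simp: set_mult_def)
  have "{b. b \<in> B \<and> a \<otimes> b \<in> C} = (\<lambda>t. inv b0 \<otimes> t) ` D"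
  proof (intro equalityI subsetI)
    fix b assume b: "b \<in> {b. b \<in> B \<and> a \<otimes> b \<in> C}"
    have "b0 \<otimes> b = inv c \<otimes> (a \<otimes> b)" using b c by (simp add: m_assoc[symmetric])
    then have "b0 \<otimes> b \<in> D" using b c int by (metis (no_types, lifting) B.m_closed C.m_closed C.m_inv_closed IntI mem_Collect_eq)
    moreover have "b = inv b0 \<otimes> (b0 \<otimes> b)" using b c by (simp add: m_assoc[symmetric])
    ultimately show "b \<in> (\<lambda>t. inv b0 \<otimes> t) ` D" by blast
  next
    fix b assume "b \<in> (\<lambda>t. inv b0 \<otimes> t) ` D"
    then obtain t where t: "t \<in> B" "t \<in> C" "b = inv b0 \<otimes> t" using int by blast
    then have "a \<otimes> b = c \<otimes> t" using c by (simp add: m_assoc) (simp add: m_assoc[symmetric])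
    then show "b \<in> {b. b \<in> B \<and> a \<otimes> b \<in> C}" using t c by auto
  qed
  moreover have "inj_on (\<lambda>t. inv b0 \<otimes> t) D"
    using int c by (intro inj_onI) (metis B.mem_carrier IntE inv_closed l_cancel)
  ultimately show ?thesis by (simp add: card_image)
qed

text \<open>A case of modularity: \<open>A'\<close> and \<open>A\<close> have the same meet and the
  same join with \<open>B\<close>, so the product formula gives them equal orders, and
  \<open>A'\<close> is contained in \<open>A\<close>.\<close>

lemma diamond_triple_shrink:
  assumes s: "subgroup A G" "subgroup B G" "subgroup A' G"
    and sub: "A \<inter> B \<subseteq> A'" "A' \<subseteq> A" and g: "A \<subseteq> generate G (A' \<union> B)"
  shows "A' = A"
proof -
  have "subgroup (generate G (A' \<union> B)) G"
    by (rule subgroup_generate_Un[OF s(3,2)])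
  then have "generate G (A \<union> B) \<subseteq> generate G (A' \<union> B)"
    using g generate.incl[of _ "A' \<union> B" G] by (intro generate_subgroup_incl) auto
  moreover have "generate G (A' \<union> B) \<subseteq> generate G (A \<union> B)"
    using sub by (intro mono_generate) auto
  moreover have "A' \<inter> B = A \<inter> B" using sub by blast
  ultimately have "card A' * card B = card A * card B"
    using card_generate_Un[OF s(1,2)] card_generate_Un[OF s(3,2)] by simp
  then have "card A' = card A" using card_subgroup_pos[OF s(2)] by simp
  then show ?thesis by (rule card_subset_eq[OF finite_subgroup[OF s(1)] sub(2)])
qed
end

text \<open>A set of three distinct elements has six orderings, and the closure assumptions
  \<open>swap\<close> and \<open>rot\<close> reach all of them.\<close>

lemma card_unordered_triples:
  assumes fin: "finite {(a, b, c). R a b c}"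
    and dist: "\<And>a b c. R a b c \<Longrightarrow> a \<noteq> b \<and> b \<noteq> c \<and> a \<noteq> c"
    and swap: "\<And>a b c. R a b c \<Longrightarrow> R b a c" and rot: "\<And>a b c. R a b c \<Longrightarrow> R b c a"
  shows "card {(a, b, c). R a b c} = card {{a, b, c} | a b c. R a b c} * 6"
proof (rule card_uniform_fibres[where f = "\<lambda>(a, b, c). {a, b, c}"])
  have "{{a, b, c} | a b c. R a b c} = (\<lambda>(a, b, c). {a, b, c}) ` {(a, b, c). R a b c}"
    by (auto simp: image_iff)
  then show "finite {{a, b, c} | a b c. R a b c}" using fin by (simp only:) (rule finite_imageI)
  show "(\<lambda>(a, b, c). {a, b, c}) ` {(a, b, c). R a b c} \<subseteq> {{a, b, c} | a b c. R a b c}" by auto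
  fix S assume "S \<in> {{a, b, c} | a b c. R a b c}"
  then obtain a b c where R: "R a b c" and S: "S = {a, b, c}" by blast
  note d = dist[OF R]
  have "{x \<in> {(a, b, c). R a b c}. (case x of (a, b, c) \<Rightarrow> {a, b, c}) = S} =
      {(a, b, c), (a, c, b), (b, a, c), (b, c, a), (c, a, b), (c, b, a)}" (is "?l = ?r")
  proof
    note 1 = rot[OF R]
    note 2 = rot[OF 1]
    show "?r \<subseteq> ?l" using R 1 2 swap[OF R] swap[OF 1] swap[OF 2] unfolding S by auto
    show "?l \<subseteq> ?r"
    proof
      fix t assume "t \<in> ?l"
      then obtain x y z where t: "t = (x, y, z)" and "R x y z" and eq: "{x, y, z} = {a, b, c}"
        unfolding S by auto
      moreover have "x \<in> {a, b, c}" "y \<in> {a, b, c}" "z \<in> {a, b, c}" using eq by blast+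
      ultimately show "t \<in> ?r" using dist[of x y z] by auto
    qed
  qed
  then show "card {x \<in> {(a, b, c). R a b c}. (case x of (a, b, c) \<Rightarrow> {a, b, c}) = S} = 6"
    using d by simp
qed fact

lemma list_all2_map2:
  "list_all2 (\<lambda>a b. b \<in> B \<and> f a b \<in> C) xs ys \<longleftrightarrow>
    length xs = length ys \<and> set ys \<subseteq> B \<and> set (map2 f xs ys) \<subseteq> C"
proof (induction xs arbitrary: ys)
  case (Cons x xs)
  then show ?case by (cases ys) auto
qed auto

section \<open>Fibres of the map from pairs of lists to ordered diamonds\<close>

context elementary_abelian
begin

text \<open>From right to left, \<open>xs\<close> generates \<open>A\<close> by its order. Over
  \<open>D\<close>, the list \<open>ys\<close> and the products generate subgroups of
  \<open>B\<close> and \<open>C\<close> whose join contains \<open>xs\<close>, hence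
  \<open>A\<close>; this makes them all of \<open>B\<close> and \<open>C\<close>. Joint independence
  is read off from the order of the join of \<open>A\<close> and \<open>B\<close>.\<close>

lemma fibre_indep_pairs:
  assumes D: "subgroup D G" and t: "(A, B, C) \<in> diamond_triples_over D i"
  shows "{(xs, ys) \<in> indep_pairs D i. generate G (D \<union> set xs) = A \<and> generate G (D \<union> set ys) = B \<and>
        generate G (D \<union> set (map2 (\<otimes>) xs ys)) = C} =
      (SIGMA xs:indep_lists D A i. {ys. list_all2 (\<lambda>a b. b \<in> B \<and> a \<otimes> b \<in> C) xs ys})" (is "?l = ?r")
proof (intro equalityI subsetI)
  have s: "subgroup A G" "subgroup B G" "subgroup C G"
    and int: "A \<inter> B = D" "C \<inter> B = D" "C \<inter> A = D"
    and gen: "generate G (A \<union> B) = generate G (B \<union> C)" "generate G (B \<union> C) = generate G (C \<union> A)"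
    and crd: "card A = card D * p ^ i" "card B = card D * p ^ i"
    using t by (auto simp: diamond_triples_over_def)
  have Dc: "D \<subseteq> carrier G" by (rule subgroup.subset[OF D])
  {
    fix z assume "z \<in> ?l"
    then obtain xs ys where z: "z = (xs, ys)" "(xs, ys) \<in> indep_pairs D i"
      and g: "generate G (D \<union> set xs) = A" "generate G (D \<union> set ys) = B"
        "generate G (D \<union> set (map2 (\<otimes>) xs ys)) = C" by auto
    have "D \<union> set xs \<subseteq> A" "D \<union> set ys \<subseteq> B" "D \<union> set (map2 (\<otimes>) xs ys) \<subseteq> C"
      unfolding g[symmetric] by (auto intro: generate.incl)
    then show "z \<in> ?r" using z unfolding mem_Sigma_iff z(1) mem_Collect_eq list_all2_map2
      by (auto simp: indep_pairs_def indep_lists_def)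
  next
    fix z assume "z \<in> ?r"
    then obtain xs ys where z: "z = (xs, ys)" and xs: "xs \<in> indep_lists D A i"
      and "list_all2 (\<lambda>a b. b \<in> B \<and> a \<otimes> b \<in> C) xs ys" by blast
    then have ys: "length xs = length ys" "set ys \<subseteq> B" "set (map2 (\<otimes>) xs ys) \<subseteq> C"
      unfolding list_all2_map2 by simp_all
    have xsA: "set xs \<subseteq> A" and len: "length xs = i" using xs by (auto simp: indep_lists_def)
    have c: "set xs \<subseteq> carrier G" "set ys \<subseteq> carrier G" "set (map2 (\<otimes>) xs ys) \<subseteq> carrier G"
      using xsA ys s[THEN subgroup.subset] by simp_all
    define B' where "B' = generate G (D \<union> set ys)"
    define C' where "C' = generate G (D \<union> set (map2 (\<otimes>) xs ys))"
    have s': "subgroup B' G" "subgroup C' G"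
      unfolding B'_def C'_def using Dc c by (auto intro!: generate_is_subgroup)
    have incl': "D \<union> set ys \<subseteq> B'" "D \<union> set (map2 (\<otimes>) xs ys) \<subseteq> C'"
      unfolding B'_def C'_def by (auto intro: generate.incl)
    have Dsub: "D \<subseteq> A" "D \<subseteq> B" "D \<subseteq> C" using int by blast+
    have "B' \<subseteq> B"
      unfolding B'_def by (rule generate_subgroup_incl[OF _ s(2)]) (use Dsub ys in simp)
    moreover have "C' \<subseteq> C"
      unfolding C'_def by (rule generate_subgroup_incl[OF _ s(3)]) (use Dsub ys in simp)
    ultimately have sub': "B' \<subseteq> B" "C' \<subseteq> C" by simp_all
    have "generate G (D \<union> set xs) \<subseteq> A"
      using Dsub xsA by (intro generate_subgroup_incl s) auto
    then have A: "generate G (D \<union> set xs) = A"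
      using xs crd by (intro card_subset_eq[OF finite_subgroup[OF s(1)]]) (auto simp: indep_lists_def indep_def)
    let ?H = "generate G (C' \<union> B')"
    have H: "subgroup ?H G" by (rule subgroup_generate_Un[OF s'(2,1)])
    have "C' \<union> B' \<subseteq> ?H" by (auto intro: generate.incl)
    then have "set ys \<subseteq> ?H" "set (map2 (\<otimes>) xs ys) \<subseteq> ?H" "D \<subseteq> ?H" using incl' by auto
    moreover from this have "set xs \<subseteq> ?H"
      using map2_mult_in_subgroup(2)[OF H ys(1) c(1,2)] by blast
    ultimately have "A \<subseteq> ?H"
      unfolding A[symmetric] by (intro generate_subgroup_incl H) auto
    moreover have "generate G (C' \<union> B') \<subseteq> generate G (C' \<union> B)" "generate G (C' \<union> B') \<subseteq> generate G (B' \<union> C)"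
      using sub' by (auto intro!: mono_generate)
    ultimately have A': "A \<subseteq> generate G (C' \<union> B)" "A \<subseteq> generate G (B' \<union> C)" by blast+
    \<comment> \<open>If the join of \<open>V'\<close> and \<open>W\<close> contains
      \<open>A\<close>, it contains the join of \<open>A\<close> and \<open>W\<close>, which is also
      that of \<open>V\<close> and \<open>W\<close>, so \<open>diamond_triple_shrink\<close>
      applies.\<close>
    have shrink: "V' = V" if "subgroup V G" "subgroup W G" "subgroup V' G" "V \<inter> W = D" "D \<subseteq> V'" "V' \<subseteq> V"
      "A \<subseteq> generate G (V' \<union> W)" "generate G (V \<union> W) = generate G (A \<union> W)" for V W V'
    proof (rule diamond_triple_shrink[of V W])
      have "subgroup (generate G (V' \<union> W)) G" by (rule subgroup_generate_Un[OF that(3,2)])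
      then have "generate G (A \<union> W) \<subseteq> generate G (V' \<union> W)"
        using that(7) by (intro generate_subgroup_incl) (auto intro: generate.incl)
      moreover have "V \<subseteq> generate G (V \<union> W)" by (auto intro: generate.incl)
      ultimately show "V \<subseteq> generate G (V' \<union> W)" using that(8) by simp
    qed (use that in auto)
    have C': "C' = C"
      by (rule shrink[of C B]) (use s s' int incl' sub' A' gen in \<open>auto simp: Un_commute\<close>)
    have B': "B' = B"
      by (rule shrink[of B C]) (use s s' int incl' sub' A' gen in \<open>auto simp: Un_commute\<close>)
    have "card (generate G (A \<union> B)) * card D = card D * p ^ i * (card D * p ^ i)"
      using card_generate_Un[OF s(1,2)] unfolding crd int(1) by (rule sym)
    then have "card (generate G (A \<union> B)) = card D * (p ^ i * p ^ i)"
      using card_subgroup_pos[OF D] by simp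
    moreover have "generate G (A \<union> B) = generate G (D \<union> set xs \<union> set ys)"
      using generate_Un_Un[OF Dc c(1,2)] A B' B'_def by simp
    ultimately have "(xs, ys) \<in> indep_pairs D i"
      unfolding mem_indep_pairs[OF D] using c len ys(1) by simp
    then show "z \<in> ?l" using z A B' C' B'_def C'_def by auto
  }
qed

text \<open>Any two of the three lists generate, together with \<open>D\<close>, the same subgroup,
  and its order is maximal for two lists of length \<open>i\<close>. So
  \<open>independent_subgroups\<close> applies to each of the three pairs.\<close>

lemma span_indep_pairs:
  assumes D: "subgroup D G" and "(xs, ys) \<in> indep_pairs D i"
  shows "(generate G (D \<union> set xs), generate G (D \<union> set ys), generate G (D \<union> set (map2 (\<otimes>) xs ys)))
    \<in> diamond_triples_over D i"
proof -
  let ?zs = "map2 (\<otimes>) xs ys"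
  let ?g = "\<lambda>us. generate G (D \<union> set us)"
  let ?T = "generate G (D \<union> set xs \<union> set ys)"
  have xs: "set xs \<subseteq> carrier G" "length xs = i" and ys: "set ys \<subseteq> carrier G" "length ys = i"
    and T: "card ?T = card D * (p ^ i * p ^ i)"
    using assms(2) by (auto simp: mem_indep_pairs[OF D])
  have Dc: "D \<subseteq> carrier G" by (rule subgroup.subset[OF D])
  have zs: "set ?zs \<subseteq> carrier G" "length ?zs = i"
    using map2_mult_in_subgroup(1)[OF subgroup_self, of xs ys] xs ys by auto
  have gen: "set us \<union> set vs \<subseteq> carrier G \<Longrightarrow> generate G (?g us \<union> ?g vs) = generate G (D \<union> set us \<union> set vs)" for us vs
    using Dc by (intro generate_Un_Un) auto
  have sT: "subgroup (generate G (D \<union> U \<union> V)) G" if "U \<subseteq> carrier G" "V \<subseteq> carrier G" for U V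
    using Dc that by (intro generate_is_subgroup) auto
  have inT: "D \<union> U \<union> V \<subseteq> generate G (D \<union> U \<union> V)" for U V by (auto intro: generate.incl)
  have le: "generate G (D \<union> U \<union> V) \<subseteq> generate G (D \<union> U' \<union> V')"
    if "U' \<subseteq> carrier G" "V' \<subseteq> carrier G" "U \<union> V \<subseteq> generate G (D \<union> U' \<union> V')" for U V U' V'
    using that inT[of U' V'] by (intro generate_subgroup_incl sT) auto
  have mx: "set xs \<subseteq> H \<Longrightarrow> set ?zs \<subseteq> H \<longleftrightarrow> set ys \<subseteq> H" and my: "set ys \<subseteq> H \<Longrightarrow> set ?zs \<subseteq> H \<longleftrightarrow> set xs \<subseteq> H"
    if "subgroup H G" for H
    using map2_mult_in_subgroup[OF that, of xs ys] xs ys by auto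
  have T1: "generate G (D \<union> set ys \<union> set ?zs) = ?T"
  proof (rule antisym)
    show "generate G (D \<union> set ys \<union> set ?zs) \<subseteq> ?T"
      using inT[of "set xs" "set ys"] mx[OF sT[OF xs(1) ys(1)]] by (intro le xs(1) ys(1)) auto
    show "?T \<subseteq> generate G (D \<union> set ys \<union> set ?zs)"
      using inT[of "set ys" "set ?zs"] my[OF sT[OF ys(1) zs(1)]] by (intro le ys(1) zs(1)) auto
  qed
  have T2: "generate G (D \<union> set ?zs \<union> set xs) = ?T"
  proof (rule antisym)
    show "generate G (D \<union> set ?zs \<union> set xs) \<subseteq> ?T"
      using inT[of "set xs" "set ys"] mx[OF sT[OF xs(1) ys(1)]] by (intro le xs(1) ys(1)) auto
    show "?T \<subseteq> generate G (D \<union> set ?zs \<union> set xs)"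
      using inT[of "set ?zs" "set xs"] mx[OF sT[OF zs(1) xs(1)]] by (intro le zs(1) xs(1)) auto
  qed
  have sg: "subgroup (?g us) G" and incl: "D \<subseteq> ?g us" and cle: "card (?g us) \<le> card D * p ^ i"
    if "set us \<subseteq> carrier G" "length us = i" for us
    using that Dc card_generate_le[OF D, of us] by (auto intro!: generate_is_subgroup intro: generate.incl)
  have ind: "?g us \<inter> ?g vs = D \<and> card (?g us) = card D * p ^ i \<and> card (?g vs) = card D * p ^ i"
    if "set us \<subseteq> carrier G" "length us = i" "set vs \<subseteq> carrier G" "length vs = i"
      "generate G (D \<union> set us \<union> set vs) = ?T" for us vs
    using that sg incl cle gen T p_gt_1 by (intro independent_subgroups[OF D]) auto
  show ?thesis
    unfolding diamond_triples_over_def mem_Collect_eq case_prod_conv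
    using ind[OF xs ys] ind[OF ys zs T1] ind[OF zs xs T2] gen[of xs ys] gen[of ys ?zs] gen[of ?zs xs]
      sg[OF xs] sg[OF ys] sg[OF zs] T1 T2 xs ys zs by simp
qed

lemma finite_subgroups: "finite {H. subgroup H G}"
  by (rule finite_subset[of _ "Pow (carrier G)"]) (auto simp: finite_carrier dest: subgroup.mem_carrier)

lemma finite_diamond_triples_over: "finite (diamond_triples_over D i)"
proof (rule finite_subset)
  let ?S = "{H. subgroup H G}"
  show "diamond_triples_over D i \<subseteq> ?S \<times> ?S \<times> ?S"
    by (auto simp: diamond_triples_over_def)
  show "finite (?S \<times> ?S \<times> ?S)" by (intro finite_cartesian_product finite_subgroups)
qed

text \<open>Counts \<open>indep_pairs\<close> along the map to the three spans. A fibre consists of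
  an independent list \<open>xs\<close> in \<open>A\<close> and, by \<open>card_matching\<close>,
  \<open>card D\<close> choices for each of the \<open>i\<close> entries of
  \<open>ys\<close>.\<close>

lemma card_diamond_triples_over:
  assumes D: "subgroup D G"
  shows "card (diamond_triples_over D i) * ((\<Prod>k<i. card D * p ^ i - card D * p ^ k) * card D ^ i) =
    (\<Prod>k<2 * i. p ^ n - card D * p ^ k)"
proof -
  let ?f = "\<lambda>(xs, ys). (generate G (D \<union> set xs), generate G (D \<union> set ys), generate G (D \<union> set (map2 (\<otimes>) xs ys)))"
  have "card (indep_pairs D i) =
      card (diamond_triples_over D i) * ((\<Prod>k<i. card D * p ^ i - card D * p ^ k) * card D ^ i)"
  proof (rule card_uniform_fibres[where f = ?f])
    show "finite (indep_pairs D i)"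
      unfolding indep_pairs_def using finite_indep_lists finite_carrier by blast
    show "finite (diamond_triples_over D i)" by (rule finite_diamond_triples_over)
    show "?f ` indep_pairs D i \<subseteq> diamond_triples_over D i" using span_indep_pairs[OF D] by auto
    fix z assume "z \<in> diamond_triples_over D i"
    then obtain A B C where z: "z = (A, B, C)" and t: "(A, B, C) \<in> diamond_triples_over D i"
      by (cases z) auto
    have A: "subgroup A G" "D \<subseteq> A" "card A = card D * p ^ i" using t by (auto simp: diamond_triples_over_def)
    let ?M = "\<lambda>xs. {ys. list_all2 (\<lambda>a b. b \<in> B \<and> a \<otimes> b \<in> C) xs ys}"
    have M: "card (?M xs) = card D ^ i" if "xs \<in> indep_lists D A i" for xs
      using that card_matching[OF t] by (subst card_list_all2[where k = "card D"]) (auto simp: indep_lists_def)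
    \<comment> \<open>An infinite set has \<open>card\<close> zero, so the positive value in
      \<open>M\<close> gives finiteness.\<close>
    have finM: "finite (?M xs)" if "xs \<in> indep_lists D A i" for xs
      using M[OF that] card_subgroup_pos[OF D] by (intro card_ge_0_finite) simp
    have "{u \<in> indep_pairs D i. ?f u = z} = (SIGMA xs:indep_lists D A i. ?M xs)"
      unfolding fibre_indep_pairs[OF D t, symmetric] z by auto
    then have "card {u \<in> indep_pairs D i. ?f u = z} = (\<Sum>xs\<in>indep_lists D A i. card (?M xs))"
      using finM finite_indep_lists finite_subgroup[OF A(1)] by (simp only:) (subst card_SigmaI, auto)
    then show "card {u \<in> indep_pairs D i. ?f u = z} = (\<Prod>k<i. card D * p ^ i - card D * p ^ k) * card D ^ i"
      using M card_indep_lists[OF D A(1,2), of i] A(3) by simp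
  qed
  then show ?thesis using card_indep_pairs[OF D] by simp
qed
end


section \<open>Summation over all diamonds\<close>

text \<open>This is \<open>(q - 1) ^ m\<close> times the \<open>q\<close>-factorial of
  \<open>m\<close>; Gaussian coefficients are quotients of such values.\<close>

definition qfact :: "real \<Rightarrow> nat \<Rightarrow> real" where
  "qfact q m = (\<Prod>k=1..m. (q ^ k - 1))"

lemma qfact_0 [simp]: "qfact q 0 = 1"
  by (simp add: qfact_def)

lemma qfact_Suc: "qfact q (Suc m) = (q ^ Suc m - 1) * qfact q m"
  by (simp add: qfact_def)

lemma qfact_pos: "q > 1 \<Longrightarrow> qfact q m > 0"
  unfolding qfact_def by (intro prod_pos) (simp add: one_less_power)

lemma gauss_coeff_qfact:
  "gauss_coeff m p i = qfact (real p) m / (qfact (real p) i * qfact (real p) (m - i))"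
  by (simp add: gauss_coeff_def qfact_def)

lemma qfact_split: "i \<le> m \<Longrightarrow> qfact q m = qfact q i * (\<Prod>k=i+1..m. (q ^ k - 1))"
  using prod.ub_add_nat[of 1 i "\<lambda>k. q ^ k - 1" "m - i"] by (simp add: qfact_def)

text \<open>Take \<open>q ^ k\<close> out of each factor \<open>q ^ m - q ^ k\<close>: the exponents
  add up to \<open>j * (j - 1) div 2\<close>, and what is left are the top \<open>j\<close> factors
  of \<open>qfact q m\<close>.\<close>

lemma prod_power_diff:
  fixes q :: real
  assumes "j \<le> m"
  shows "(\<Prod>k<j. q ^ m - q ^ k) * qfact q (m - j) = q ^ (j * (j - 1) div 2) * qfact q m"
  using assms
proof (induction j)
  case (Suc j)
  define l where "l = m - Suc j"
  have m: "m = Suc j + l" using Suc.prems by (simp add: l_def)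
  have "j * (j - 1) + 2 * j = Suc j * j" by (cases j) auto
  then have e: "j * (j - 1) div 2 + j = Suc j * (Suc j - 1) div 2"
    using div_mult_self2[of 2 "j * (j - 1)" j] by simp
  have "(\<Prod>k<Suc j. q ^ m - q ^ k) * qfact q (m - Suc j) =
      (\<Prod>k<j. q ^ m - q ^ k) * q ^ j * ((q ^ Suc l - 1) * qfact q l)"
    by (simp add: m algebra_simps power_add)
  also have "\<dots> = (\<Prod>k<j. q ^ m - q ^ k) * qfact q (m - j) * q ^ j"
    by (simp add: m qfact_Suc)
  also have "\<dots> = q ^ (j * (j - 1) div 2 + j) * qfact q m"
    using Suc by (simp add: power_add)
  finally show ?case unfolding e .
qed simp

text \<open>As \<open>k < j \<le> m\<close>, no subtraction is truncated, and each factor is a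
  multiple of \<open>p ^ d\<close>.\<close>

lemma real_prod_power_diff:
  assumes "j \<le> m" "p \<ge> 1"
  shows "real (\<Prod>k<j. p ^ (d + m) - p ^ d * p ^ k) = real p ^ (d * j) * (\<Prod>k<j. real p ^ m - real p ^ k)"
proof -
  have "real (p ^ (d + m) - p ^ d * p ^ k) = real p ^ d * (real p ^ m - real p ^ k)" if "k < j" for k
  proof -
    have "p ^ d * p ^ k \<le> p ^ (d + m)"
      using that assms by (auto simp: power_add intro!: power_increasing)
    then show ?thesis by (simp add: of_nat_diff power_add algebra_simps)
  qed
  then show ?thesis by (simp add: prod.distrib power_mult)
qed

text \<open>The source of the exponent in the theorem: the power of \<open>p\<close> contributed by
  \<open>2 * i\<close> chosen entries, less that of the \<open>i\<close> entries inside
  \<open>A\<close>. The products on the left are even, so their halves may be added.\<close>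

lemma triangular_exponents:
  fixes i :: nat
  shows "i * (i - 1) div 2 + i * (3 * i - 1) div 2 = 2 * i * (2 * i - 1) div 2"
proof (cases i)
  case (Suc m)
  have "i * (i - 1) + i * (3 * i - 1) = 2 * i * (2 * i - 1)"
    by (simp add: Suc algebra_simps)
  moreover have "even (i * (i - 1))" "even (i * (3 * i - 1))" by (auto simp: Suc)
  ultimately show ?thesis by (metis div_add)
qed simp

section \<open>Closed forms in terms of Gaussian coefficients\<close>

context elementary_abelian
begin

lemma card_subgroups:
  assumes "i \<le> n"
  shows "real (card {H. subgroup H G \<and> card H = p ^ i}) = gauss_coeff n p i" (is "real ?S = _")
proof -
  let ?q = "real p" and ?e = "i * (i - 1) div 2"
  have q: "?q > 1" "p \<ge> 1" using p_gt_1 by simp_all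
  have "real ?S * (\<Prod>k<i. ?q ^ i - ?q ^ k) = (\<Prod>k<i. ?q ^ n - ?q ^ k)"
    using arg_cong[OF card_subgroups_mult[of i], of real]
      real_prod_power_diff[of i n p 0] real_prod_power_diff[of i i p 0] assms q(2) by simp
  \<comment> \<open>The factor \<open>qfact ?q (i - i)\<close> is 1; it is inserted so that
    \<open>prod_power_diff\<close> applies on the left too, after which both sides carry the same
    power of \<open>p\<close>.\<close>
  then have "real ?S * ((\<Prod>k<i. ?q ^ i - ?q ^ k) * qfact ?q (i - i)) * qfact ?q (n - i) =
      (\<Prod>k<i. ?q ^ n - ?q ^ k) * qfact ?q (n - i)" by simp
  then have "?q ^ ?e * (real ?S * (qfact ?q i * qfact ?q (n - i))) = ?q ^ ?e * qfact ?q n"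
    unfolding prod_power_diff[OF assms] prod_power_diff[OF order_refl] by (simp add: mult_ac)
  then have "real ?S * (qfact ?q i * qfact ?q (n - i)) = qfact ?q n" using q by simp
  then show ?thesis
    unfolding gauss_coeff_qfact
    using qfact_pos[OF q(1), of i] qfact_pos[OF q(1), of "n - i"] by (simp add: eq_divide_eq)
qed

text \<open>The lists in \<open>A\<close> and the coset choices each contribute
  \<open>p ^ (d * i)\<close>, cancelling \<open>p ^ (d * (2 * i))\<close> on the other side. So for
  given \<open>i\<close> the count depends on \<open>n - d\<close> only, as for a trivial bottom in
  the quotient by \<open>D\<close>.\<close>

lemma real_card_diamond_triples_over:
  assumes D: "subgroup D G" "card D = p ^ d" and le: "d + 2 * i \<le> n"
  shows "real (card (diamond_triples_over D i)) =
    real p ^ (i * (3 * i - 1) div 2) * gauss_coeff (n - d) p (2 * i) * (\<Prod>k=i+1..2*i. (real p ^ k - 1))"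
    (is "real ?S = _")
proof -
  define m where "m = n - d"
  have n: "n = d + m" and m: "2 * i \<le> m" using le by (simp_all add: m_def)
  let ?q = "real p" and ?e = "i * (i - 1) div 2" and ?e' = "i * (3 * i - 1) div 2"
  have q: "?q > 1" "p \<ge> 1" using p_gt_1 by simp_all
  let ?P = "\<lambda>j m. \<Prod>k<j. ?q ^ m - ?q ^ k"
  have e: "?q ^ (d * (2 * i)) = ?q ^ (d * i) * (?q ^ d) ^ i"
    by (simp add: mult_2 distrib_left power_add power_mult)
  have "real (?S * ((\<Prod>k<i. p ^ (d + i) - p ^ d * p ^ k) * (p ^ d) ^ i)) = real (\<Prod>k<2 * i. p ^ (d + m) - p ^ d * p ^ k)"
    using card_diamond_triples_over[OF D(1), of i] by (simp only: D(2) n power_add)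
  then have "real ?S * (real (\<Prod>k<i. p ^ (d + i) - p ^ d * p ^ k) * (?q ^ d) ^ i) = real (\<Prod>k<2 * i. p ^ (d + m) - p ^ d * p ^ k)"
    by (simp only: of_nat_mult of_nat_power)
  then have "real ?S * ((?q ^ (d * i) * ?P i i) * (?q ^ d) ^ i) = ?q ^ (d * (2 * i)) * ?P (2 * i) m"
    unfolding real_prod_power_diff[OF order_refl q(2)] real_prod_power_diff[OF m q(2)] .
  then have "?q ^ (d * (2 * i)) * (real ?S * ?P i i) = ?q ^ (d * (2 * i)) * ?P (2 * i) m"
    unfolding e by (simp only: mult_ac)
  then have "real ?S * (?P i i * qfact ?q (i - i)) * qfact ?q (m - 2 * i) = ?P (2 * i) m * qfact ?q (m - 2 * i)"
    using q by simp
  then have "real ?S * (?q ^ ?e * qfact ?q i) * qfact ?q (m - 2 * i) = ?q ^ (2 * i * (2 * i - 1) div 2) * qfact ?q m"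
    unfolding prod_power_diff[OF m] prod_power_diff[OF order_refl] .
  then have "?q ^ ?e * (real ?S * qfact ?q i * qfact ?q (m - 2 * i)) = ?q ^ ?e * (?q ^ ?e' * qfact ?q m)"
    unfolding triangular_exponents[symmetric] power_add by (simp only: mult_ac)
  then have "real ?S * qfact ?q i * qfact ?q (m - 2 * i) = ?q ^ ?e' * qfact ?q m"
    using q by simp
  \<comment> \<open>As \<open>qfact ?q (2 * i) = qfact ?q i * R\<close>, expanding the quotient by
    \<open>R\<close> turns the denominator \<open>qfact ?q i\<close> into that of the Gaussian
    coefficient and leaves \<open>R\<close> as a factor.\<close>
  moreover define R where "R = (\<Prod>k=i+1..2*i. (?q ^ k - 1))"
  have "qfact ?q (2 * i) = qfact ?q i * R"
    unfolding R_def by (rule qfact_split) simp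
  moreover have "R > 0" unfolding R_def using q by (intro prod_pos) (simp add: one_less_power)
  moreover note qfact_pos[OF q(1), of i] qfact_pos[OF q(1), of "m - 2 * i"]
  ultimately show ?thesis
    unfolding gauss_coeff_qfact m_def[symmetric] R_def[symmetric] by (simp add: field_simps)
qed

text \<open>The product formula for the three pairs gives the middle elements a common order
  \<open>p ^ a\<close>, with \<open>2 * a = m + d\<close> if bottom and top have orders
  \<open>p ^ d\<close> and \<open>p ^ m\<close>. For \<open>i = a - d\<close> this reads
  \<open>m = d + 2 * i\<close>, and \<open>m \<le> n\<close>.\<close>

lemma diamond_triple_iff:
  "diamond_triple A B C \<longleftrightarrow>
    (\<exists>i d D. 1 \<le> i \<and> d + 2 * i \<le> n \<and> subgroup D G \<and> card D = p ^ d \<and> (A, B, C) \<in> diamond_triples_over D i)"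
  (is "?l \<longleftrightarrow> ?r")
proof
  assume t: ?l
  then have s: "subgroup A G" "subgroup B G" "subgroup C G"
    and int: "A \<inter> B = B \<inter> C" "B \<inter> C = C \<inter> A"
    and gen: "generate G (A \<union> B) = generate G (B \<union> C)" "generate G (B \<union> C) = generate G (C \<union> A)"
    by (auto simp: diamond_triple_def)
  define D T where "D = A \<inter> B" and "T = generate G (A \<union> B)"
  have D: "subgroup D G" unfolding D_def by (rule subgroups_Inter_pair[OF s(1,2)])
  have T: "subgroup T G" unfolding T_def by (rule subgroup_generate_Un[OF s(1,2)])
  have AB: "card A * card B = card T * card D" and BC: "card B * card C = card T * card D"
    and CA: "card C * card A = card T * card D"
    using card_generate_Un[OF s(1,2)] card_generate_Un[OF s(2,3)] card_generate_Un[OF s(3,1)] int gen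
    by (simp_all add: D_def T_def)
  have B: "card B = card A" and C: "card C = card A"
    using AB BC CA card_subgroup_pos[OF s(1)] card_subgroup_pos[OF s(2)] card_subgroup_pos[OF s(3)]
    by (metis mult.commute mult_cancel1 less_numeral_extra(3))+
  obtain a where a: "card A = p ^ a" using card_subgroup_power[OF s(1)] by blast
  obtain d where d: "card D = p ^ d" using card_subgroup_power[OF D] by blast
  obtain m where m: "card T = p ^ m" "m \<le> n" using card_subgroup_power[OF T] by blast
  have "D \<noteq> A" using diamond_triple_D[OF t] by (auto simp: D_def)
  then have "card D < card A"
    using psubset_card_mono[OF finite_subgroup[OF s(1)], of D] by (auto simp: D_def)
  then have "d < a" using a d p_gt_1 by simp
  moreover have "p ^ (a + a) = p ^ (m + d)" using AB a d m B by (simp add: power_add)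
  then have "a + a = m + d" using p_gt_1 power_inject_exp by blast
  moreover have "card A = card D * p ^ (a - d)"
    using a d \<open>d < a\<close> by (simp flip: power_add)
  then have "(A, B, C) \<in> diamond_triples_over D (a - d)"
    using s int gen B C by (auto simp: diamond_triples_over_def D_def)
  ultimately show ?r using D d m(2) by (intro exI[of _ "a - d"] exI[of _ d] exI[of _ D]) auto
next
  assume ?r
  then obtain i d D where i: "1 \<le> i" and D: "subgroup D G" and t: "(A, B, C) \<in> diamond_triples_over D i"
    by blast
  then have c: "card A = card D * p ^ i" "card B = card D * p ^ i" "card C = card D * p ^ i"
    and int: "A \<inter> B = D" "B \<inter> C = D" "C \<inter> A = D"
    by (auto simp: diamond_triples_over_def)
  have "card D < card D * p ^ i"
    using one_less_power[OF p_gt_1, of i] i card_subgroup_pos[OF D] by simp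
  then have "A \<noteq> D" "B \<noteq> D" using c by auto
  then have "A \<noteq> B" "B \<noteq> C" "A \<noteq> C" using int by blast+
  then show ?l using t by (auto simp: diamond_triples_over_def diamond_triple_def)
qed

lemma real_dm:
  "real (dm G) = 1 / 6 * (\<Sum>i=1..n div 2. real p ^ (i * (3 * i - 1) div 2) * gauss_coeff n p (2 * i)
      * (\<Sum>j=0..n - 2 * i. gauss_coeff (n - 2 * i) p j) * (\<Prod>k=i+1..2*i. (real p ^ k - 1)))"
proof -
  let ?S = "\<lambda>d. {H. subgroup H G \<and> card H = p ^ d}"
  let ?T = "{(A, B, C). diamond_triple A B C}"
  \<comment> \<open>Ordered diamonds tagged with \<open>i\<close>, the exponent \<open>d\<close> of
    the order of the bottom, and the bottom \<open>D\<close> itself.\<close>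
  let ?U = "SIGMA i:{1..n div 2}. SIGMA d:{0..n - 2 * i}. SIGMA D:?S d. diamond_triples_over D i"
  have finS: "finite (?S d)" for d by (rule finite_subset[OF _ finite_subgroups]) auto
  have fin: "finite ?U" using finS finite_diamond_triples_over by (intro finite_SigmaI) auto
  \<comment> \<open>The tags are recovered from the triple: \<open>D = A \<inter> B\<close>, its
    order gives \<open>d\<close>, and \<open>card A\<close> gives \<open>i\<close>.\<close>
  have "inj_on (\<lambda>(i, d, D, t). t) ?U"
  proof (rule inj_onI)
    fix u v assume uv: "u \<in> ?U" "v \<in> ?U" and "(\<lambda>(i, d, D, t). t) u = (\<lambda>(i, d, D, t). t) v"
    then obtain i d D i' d' D' t where u: "u = (i, d, D, t)" and v: "v = (i', d', D', t)"
      by (cases u; cases v) auto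
    obtain A B C where t: "t = (A, B, C)" by (cases t) auto
    have tD: "(A, B, C) \<in> diamond_triples_over D i" and tD': "(A, B, C) \<in> diamond_triples_over D' i'"
      and D: "subgroup D G" and d: "card D = p ^ d" "card D' = p ^ d'"
      using uv unfolding u v t by simp_all
    have "D = D'" using tD tD' unfolding diamond_triples_over_def by simp
    moreover have "p ^ d = p ^ d'" using d \<open>D = D'\<close> by simp
    then have "d = d'" using p_gt_1 power_inject_exp by blast
    moreover have "card D * p ^ i = card D * p ^ i'"
      using tD tD' \<open>D = D'\<close> unfolding diamond_triples_over_def by simp
    then have "p ^ i = p ^ i'" using card_subgroup_pos[OF D] by simp
    then have "i = i'" using p_gt_1 power_inject_exp by blast
    ultimately show "u = v" by (simp add: u v)
  qed
  moreover have "(\<lambda>(i, d, D, t). t) ` ?U = ?T"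
  proof (intro equalityI subsetI)
    fix t assume "t \<in> (\<lambda>(i, d, D, t). t) ` ?U"
    then obtain i d D where *: "1 \<le> i" "i \<le> n div 2" "d \<le> n - 2 * i" "D \<in> ?S d" "t \<in> diamond_triples_over D i"
      by auto
    moreover have "d + 2 * i \<le> n" using * by linarith
    ultimately show "t \<in> ?T" using diamond_triple_iff by (cases t) blast
  next
    fix t assume "t \<in> ?T"
    then obtain i d D where *: "1 \<le> i" "d + 2 * i \<le> n" "D \<in> ?S d" "t \<in> diamond_triples_over D i"
      using diamond_triple_iff by (cases t) blast
    then have "(i, d, D, t) \<in> ?U" by auto
    then show "t \<in> (\<lambda>(i, d, D, t). t) ` ?U" by force
  qed
  ultimately have card_T: "card ?T = card ?U" and fin_T: "finite ?T"
    using card_image[of "\<lambda>(i, d, D, t). t" ?U] finite_imageI[OF fin, of "\<lambda>(i, d, D, t). t"] by simp_all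
  have "card ?T = card {{A, B, C} | A B C. diamond_triple A B C} * 6"
    by (rule card_unordered_triples[OF fin_T]) (auto simp: diamond_triple_def Un_commute Int_commute)
  then have "6 * real (dm G) = real (card ?U)"
    unfolding dm_eq_card_triples card_T by simp
  also have "\<dots> = (\<Sum>i=1..n div 2. \<Sum>d=0..n - 2 * i. \<Sum>D\<in>?S d. real (card (diamond_triples_over D i)))"
    using finS finite_diamond_triples_over by (simp add: card_SigmaI)
  also have "\<dots> = (\<Sum>i=1..n div 2. \<Sum>d=0..n - 2 * i. real p ^ (i * (3 * i - 1) div 2) * gauss_coeff n p (2 * i)
      * gauss_coeff (n - 2 * i) p d * (\<Prod>k=i+1..2*i. (real p ^ k - 1)))"
  proof (intro sum.cong refl)
    fix i d assume "i \<in> {1..n div 2}" "d \<in> {0..n - 2 * i}"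
    then have le: "d + 2 * i \<le> n" by auto
    have comm: "n - 2 * i - d = n - d - 2 * i" by simp
    \<comment> \<open>Both sides are the Gaussian multinomial coefficient with parts
      \<open>d\<close>, \<open>2 * i\<close> and \<open>n - d - 2 * i\<close>. On the right only the
      second factor depends on \<open>d\<close>.\<close>
    have "gauss_coeff n p d * gauss_coeff (n - d) p (2 * i) = gauss_coeff n p (2 * i) * gauss_coeff (n - 2 * i) p d"
      unfolding gauss_coeff_qfact comm using qfact_pos[of "real p"] p_gt_1 by (simp add: less_imp_neq[symmetric])
    moreover have "(\<Sum>D\<in>?S d. real (card (diamond_triples_over D i))) = gauss_coeff n p d *
      (real p ^ (i * (3 * i - 1) div 2) * gauss_coeff (n - d) p (2 * i) * (\<Prod>k=i+1..2*i. (real p ^ k - 1)))"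
      using real_card_diamond_triples_over[OF _ _ le] card_subgroups[of d] le by simp
    ultimately show "(\<Sum>D\<in>?S d. real (card (diamond_triples_over D i))) =
        real p ^ (i * (3 * i - 1) div 2) * gauss_coeff n p (2 * i) * gauss_coeff (n - 2 * i) p d * (\<Prod>k=i+1..2*i. (real p ^ k - 1))"
      by (simp add: mult_ac)
  qed
  finally show ?thesis by (simp flip: sum_distrib_left sum_distrib_right)
qed

end

section \<open>The group Z_p^n as an instance\<close>

lemma pow_product_group:
  fixes k :: nat
  assumes "\<And>i. i \<in> I \<Longrightarrow> group (H i)" "x \<in> carrier (product_group I H)"
  shows "x [^]\<^bsub>product_group I H\<^esub> k = (\<lambda>i\<in>I. x i [^]\<^bsub>H i\<^esub> k)"
  by (induction k) (auto simp: fun_eq_iff)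

lemma elementary_abelian_elementary_abelian_group:
  assumes "Factorial_Ring.prime p"
  shows "elementary_abelian (elementary_abelian_group p n) p n"
proof -
  let ?Z = "\<lambda>_. integer_mod_group p"
  \<comment> \<open>Positivity makes the factors finite: \<open>integer_mod_group 0\<close> is the
    group of all integers.\<close>
  have p: "p > 0" using assms prime_gt_0_nat by blast
  interpret group "elementary_abelian_group p n"
    unfolding elementary_abelian_group_def by (rule product_group) simp
  interpret comm_group "elementary_abelian_group p n"
    by (rule group_comm_groupI) (auto simp: elementary_abelian_group_def add.commute)
  show ?thesis
  proof
    show "order (elementary_abelian_group p n) = p ^ n"
      using p by (simp add: order_def elementary_abelian_group_def card_PiE carrier_integer_mod_group)
    fix x assume x: "x \<in> carrier (elementary_abelian_group p n)"
    then show "x [^]\<^bsub>elementary_abelian_group p n\<^esub> p = \<one>\<^bsub>elementary_abelian_group p n\<^esub>"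
      unfolding elementary_abelian_group_def by (subst pow_product_group) auto
  qed fact
qed

theorem theorem3p1:
  fixes p n :: nat
  assumes "Factorial_Ring.prime p" and "n \<ge> 1"
  shows "real (dm (elementary_abelian_group p n)) =
      1 / 6 * (\<Sum>i=1..n div 2. real p ^ (i * (3 * i - 1) div 2) * gauss_coeff n p (2 * i)
        * (\<Sum>j=0..n - 2 * i. gauss_coeff (n - 2 * i) p j) * (\<Prod>k=i+1..2*i. (real p ^ k - 1)))
    \<and> (\<forall>m i. i \<le> m \<longrightarrow>
        real (card {H. subgroup H (elementary_abelian_group p m) \<and> card H = p ^ i}) = gauss_coeff m p i)"
  using elementary_abelian.real_dm elementary_abelian.card_subgroups
    elementary_abelian_elementary_abelian_group[OF assms(1)] by blast

end
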